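(* Let $X$ be a proper Busemann space and let $\xi,\eta\in\partial_gX$. If $\operatorname{Td}(\xi,\eta)>\pi$, then there exists a geodesic $a:\mathbb{R}\to X$ with ends $a(-\infty)=\xi$ and $a(+\infty)=\eta$.
   Context: Busemann space: a geodesic metric space $X$ (distance written $|xy|$) such that for any two geodesic segments with affine parameterizations $\gamma:[a,b]\to X$, $\gamma':[a',b']\to X$ the function $(t,t')\mapsto|\gamma(t)\gamma'(t')|$ is convex. Proper means closed balls are compact. A ray is a distance-preserving map $c:\mathbb{R}_+=[0,\infty)\to X$; a (complete) geodesic $a:\mathbb{R}\to X$ is a distance-preserving map. Two rays are asymptotic if the Hausdorff distance between their images is finite; $\partial_gX$ (geodesic boundary) is the set of asymptoticity classes of rays, and $c(+\infty)$ denotes the class of $c$. For a geodesic $a:\mathbb{R}\to X$, $a(+\infty)$ is the class of the ray $t\mapsto a(t)$, $t\ge 0$, and $a(-\infty)$ the class of the ray $t\mapsto a(-t)$, $t\ge0$. For each $x\in X$, $\xi\in\partial_gX$ there is a unique ray $[x\xi]$ starting at $x$ in the class $\xi$. Cone topology on $\partial_gX$: fixing $o\in X$, a base of neighbourhoods of $\xi$ is given by the sets $\{\eta\in\partial_gX : |c_\xi(K)c_\eta(K)|<1\}$, $K>0$, where $c_\xi,c_\eta$ are the naturally parameterized rays $[o\xi],[o\eta]$ (the topology is independent of $o$). For $o\in X$, $\xi,\eta\in\partial_gX$ and $c=[o\xi]$, $d=[o\eta]$, put $\delta_o(\xi,\eta)=\lim_{t\to+\infty}\frac{|c(t)d(t)|}{2t}\le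 1$ (the quotient is non-decreasing in $t$; the limit is independent of $o$). The symbol $\operatorname{Td}$ is not a metric; it denotes the following binary relations on $\partial_gX$: - $\operatorname{Td}(\xi,\eta)<\pi$ if $\delta_o(\xi,\eta)<1$; - $\operatorname{Td}(\xi,\eta)\le\pi$ if for any neighbourhoods $U$ of $\xi$ and $V$ of $\eta$ in the cone topology there are $\xi'\in U$, $\eta'\in V$ with $\operatorname{Td}(\xi',\eta')<\pi$; - $\operatorname{Td}(\xi,\eta)\ge\pi$ if $\operatorname{Td}(\xi,\eta)<\pi$ does not hold; - $\operatorname{Td}(\xi,\eta)>\pi$ if $\operatorname{Td}(\xi,\eta)\le\pi$ does not hold; - $\operatorname{Td}(\xi,\eta)=\pi$ if both $\operatorname{Td}(\xi,\eta)\ge\pi$ and $\operatorname{Td}(\xi,\eta)\le\pi$ hold. *)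

theory Defs
  imports "HOL-Analysis.Analysis"
begin

definition isometric_on :: "real set \<Rightarrow> (real \<Rightarrow> 'a::metric_space) \<Rightarrow> bool" where
  "isometric_on I c \<longleftrightarrow> (\<forall>s\<in>I. \<forall>t\<in>I. dist (c s) (c t) = \<bar>s - t\<bar>)"

text \<open>The speed \<open>v = 0\<close> (a degenerate, one-point segment) is allowed.\<close>

definition affine_geodesic :: "real \<Rightarrow> real \<Rightarrow> (real \<Rightarrow> 'a::metric_space) \<Rightarrow> bool" where
  "affine_geodesic a b \<gamma> \<longleftrightarrow>
     a \<le> b \<and> (\<exists>v\<ge>0. \<forall>s\<in>{a..b}. \<forall>t\<in>{a..b}. dist (\<gamma> s) (\<gamma> t) = v * \<bar>s - t\<bar>)"

class geodesic_space = metric_space +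
  assumes geodesic_exists:
    "\<exists>\<gamma>. \<gamma> 0 = x \<and> \<gamma> (dist x y) = y \<and> isometric_on {0..dist x y} \<gamma>"

class busemann_space = geodesic_space +
  assumes busemann_convex:
    "affine_geodesic a b \<gamma> \<Longrightarrow> affine_geodesic a' b' \<gamma>' \<Longrightarrow>
     convex_on ({a..b} \<times> {a'..b'}) (\<lambda>(t, t'). dist (\<gamma> t) (\<gamma>' t'))"

class proper_space = metric_space +
  assumes compact_cball_proper: "compact (cball x r)"

text \<open>A map defined on \<open>[0,\<infinity>)\<close> is encoded as a total function that is \<^const>\<open>undefined\<close>
  on the negative reals, so that equality of rays is equality of maps on \<open>[0,\<infinity>)\<close>.\<close>

definition rays :: "(real \<Rightarrow> 'a::metric_space) set" where
  "rays = {c \<in> extensional {0..}. isometric_on {0..} c}"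

definition hausdorff_dist :: "'a::metric_space set \<Rightarrow> 'a set \<Rightarrow> ennreal" where
  "hausdorff_dist A B =
     max (SUP a\<in>A. INF b\<in>B. ennreal (dist a b)) (SUP b\<in>B. INF a\<in>A. ennreal (dist a b))"

definition asymptotic :: "((real \<Rightarrow> 'a::metric_space) \<times> (real \<Rightarrow> 'a)) set" where
  "asymptotic = {(c, d) \<in> rays \<times> rays. hausdorff_dist (c ` {0..}) (d ` {0..}) < \<infinity>}"

definition geodesic_boundary :: "(real \<Rightarrow> 'a::metric_space) set set" where
  "geodesic_boundary = rays // asymptotic"

definition ray_end :: "(real \<Rightarrow> 'a::metric_space) \<Rightarrow> (real \<Rightarrow> 'a) set" where
  "ray_end c = asymptotic `` {c}"

definition geodesic_line :: "(real \<Rightarrow> 'a::metric_space) \<Rightarrow> bool" where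
  "geodesic_line a \<longleftrightarrow> isometric_on UNIV a"

definition end_pos :: "(real \<Rightarrow> 'a::metric_space) \<Rightarrow> (real \<Rightarrow> 'a) set" where
  "end_pos a = ray_end (\<lambda>t\<in>{0..}. a t)"

definition end_neg :: "(real \<Rightarrow> 'a::metric_space) \<Rightarrow> (real \<Rightarrow> 'a) set" where
  "end_neg a = ray_end (\<lambda>t\<in>{0..}. a (- t))"

text \<open>The ray \<open>[x\<xi>]\<close>; it exists and is unique in a proper Busemann space.\<close>

definition ray_from :: "'a::metric_space \<Rightarrow> (real \<Rightarrow> 'a) set \<Rightarrow> real \<Rightarrow> 'a" where
  "ray_from x \<xi> = (THE c. c \<in> \<xi> \<and> c 0 = x)"

definition cone_basic_nbhd ::
    "'a::metric_space \<Rightarrow> (real \<Rightarrow> 'a) set \<Rightarrow> real \<Rightarrow> (real \<Rightarrow> 'a) set set" where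
  "cone_basic_nbhd p \<xi> K =
     {\<eta> \<in> geodesic_boundary. dist (ray_from p \<xi> K) (ray_from p \<eta> K) < 1}"

text \<open>The cone topology is specified by a neighbourhood base at each point, so a neighbourhood
  (not necessarily open) of \<open>\<xi>\<close> is a set of boundary points containing a basic one.\<close>

definition cone_nbhd ::
    "'a::metric_space \<Rightarrow> (real \<Rightarrow> 'a) set \<Rightarrow> (real \<Rightarrow> 'a) set set \<Rightarrow> bool" where
  "cone_nbhd p \<xi> U \<longleftrightarrow> U \<subseteq> geodesic_boundary \<and> (\<exists>K>0. cone_basic_nbhd p \<xi> K \<subseteq> U)"

definition delta :: "'a::metric_space \<Rightarrow> (real \<Rightarrow> 'a) set \<Rightarrow> (real \<Rightarrow> 'a) set \<Rightarrow> real" where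
  "delta p \<xi> \<eta> = Lim at_top (\<lambda>t. dist (ray_from p \<xi> t) (ray_from p \<eta> t) / (2 * t))"

text \<open>The relations \<open>Td < \<pi>\<close>, \<open>Td \<le> \<pi>\<close> and \<open>Td > \<pi>\<close>. In a proper Busemann space neither
  \<open>delta\<close> nor the cone topology depends on the base point \<open>p\<close>, which is an explicit argument here.\<close>

definition Td_less_pi :: "'a::metric_space \<Rightarrow> (real \<Rightarrow> 'a) set \<Rightarrow> (real \<Rightarrow> 'a) set \<Rightarrow> bool" where
  "Td_less_pi p \<xi> \<eta> \<longleftrightarrow> delta p \<xi> \<eta> < 1"

definition Td_le_pi :: "'a::metric_space \<Rightarrow> (real \<Rightarrow> 'a) set \<Rightarrow> (real \<Rightarrow> 'a) set \<Rightarrow> bool" where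
  "Td_le_pi p \<xi> \<eta> \<longleftrightarrow>
     (\<forall>U V. cone_nbhd p \<xi> U \<longrightarrow> cone_nbhd p \<eta> V \<longrightarrow> (\<exists>\<xi>'\<in>U. \<exists>\<eta>'\<in>V. Td_less_pi p \<xi>' \<eta>'))"

definition Td_greater_pi :: "'a::metric_space \<Rightarrow> (real \<Rightarrow> 'a) set \<Rightarrow> (real \<Rightarrow> 'a) set \<Rightarrow> bool" where
  "Td_greater_pi p \<xi> \<eta> \<longleftrightarrow> \<not> Td_le_pi p \<xi> \<eta>"

end

theory Submission
  imports Defs "HOL-Library.Diagonal_Subsequence"
begin

text \<open>
  Let \<open>c = [p\<xi>]\<close>, \<open>d = [p\<eta>]\<close> and let \<open>\<sigma>\<^sub>n\<close> be the segment from \<open>c(n)\<close> to \<open>d(n)\<close>, at distance \<open>R\<^sub>n\<close>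
  from \<open>p\<close>. If \<open>R\<^sub>n\<close> stays bounded along a subsequence, a limit of the \<open>\<sigma>\<^sub>n\<close> is the required geodesic.
  Otherwise \<open>R\<^sub>n\<close> tends to infinity. Pick \<open>K\<close> such that \<open>\<delta> = 1\<close> on the product of the basic
  neighbourhoods of \<open>\<xi>\<close> and \<open>\<eta>\<close> at radius \<open>K\<close>. Seen from \<open>p\<close>, the points of \<open>\<sigma>\<^sub>n\<close> farther than a fixed
  multiple of \<open>R\<^sub>n\<close> from its point nearest to \<open>p\<close> lie in directions close to \<open>\<xi>\<close> or \<open>\<eta>\<close>; so there are
  \<open>x, y \<in> \<sigma>\<^sub>n\<close>, both at distance comparable to \<open>R\<^sub>n\<close> from \<open>p\<close>, such that \<open>[px]\<close> and \<open>c\<close> are at distance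
  exactly \<open>1/2\<close> at radius \<open>K\<close>, and \<open>[py]\<close> and \<open>d\<close> at distance at most \<open>1/2\<close>. Since \<open>\<delta> = 1\<close> for the limit
  directions, \<open>|xy| \<ge> |px| + |py| - o(R\<^sub>n)\<close>, hence \<open>|x c(n)| = |c(n) y| - |xy| \<le> n - |px| + o(R\<^sub>n)\<close>.
  Convexity along \<open>[px]\<close> brings this error down to \<open>o(1)\<close>: the point \<open>w\<close> of \<open>[px]\<close> at distance \<open>K\<close> from
  \<open>p\<close> satisfies \<open>|w c(n)| \<le> n - K + o(1)\<close>. In the limit \<open>w\<close> lies on a ray from \<open>p\<close> in the class \<open>\<xi>\<close>, so
  \<open>w = c(K)\<close>, which contradicts the distance \<open>1/2\<close>.
\<close>

section \<open>Geodesics in Busemann spaces\<close>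

lemma isometric_onD:
  "isometric_on I c \<Longrightarrow> s \<in> I \<Longrightarrow> t \<in> I \<Longrightarrow> dist (c s) (c t) = \<bar>s - t\<bar>"
  by (simp add: isometric_on_def)

lemma isometric_on_subset: "isometric_on I c \<Longrightarrow> J \<subseteq> I \<Longrightarrow> isometric_on J c"
  by (auto simp: isometric_on_def)

lemma isometric_on_reflect:
  assumes "isometric_on {0..l} u"
  shows "isometric_on {0..l} (\<lambda>t. u (l - t))"
  using assms by (auto simp: isometric_on_def)

lemma isometric_on_shift:
  assumes "isometric_on {a..b} u"
  shows "isometric_on {a - s..b - s} (\<lambda>t. u (s + t))"
  using assms by (auto simp: isometric_on_def)

lemma isometric_imp_affine_geodesic:
  assumes "isometric_on {0..a} u" "0 \<le> a"
  shows "affine_geodesic 0 a u"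
  unfolding affine_geodesic_def
  using assms by (auto simp: isometric_on_def intro!: exI[of _ 1])

lemma geodesic_convex:
  fixes u v :: "real \<Rightarrow> 'a::busemann_space"
  assumes "isometric_on {0..a} u" "isometric_on {0..b} v" "0 \<le> a" "0 \<le> b" "0 \<le> l" "l \<le> 1"
  shows "dist (u (l * a)) (v (l * b)) \<le> (1 - l) * dist (u 0) (v 0) + l * dist (u a) (v b)"
proof -
  have "convex_on ({0..a} \<times> {0..b}) (\<lambda>(t, t'). dist (u t) (v t'))"
    using assms by (intro busemann_convex isometric_imp_affine_geodesic)
  from convex_onD[OF this, of l "(0, 0)" "(a, b)"] show ?thesis
    using assms by simp
qed

lemma geodesic_star_convex:
  fixes u v :: "real \<Rightarrow> 'a::busemann_space"
  assumes "isometric_on {0..a} u" "isometric_on {0..b} v" "0 \<le> a" "0 \<le> b" "0 \<le> l" "l \<le> 1"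
    and "u 0 = v 0"
  shows "dist (u (l * a)) (v (l * b)) \<le> l * dist (u a) (v b)"
  using geodesic_convex[OF assms(1-6)] assms(7) by simp

lemma geodesic_length_diff:
  assumes "isometric_on {0..a} u" "isometric_on {0..b} v" "0 \<le> a" "0 \<le> b" "u 0 = v 0"
  shows "\<bar>a - b\<bar> \<le> dist (u a) (v b)"
proof -
  have "dist (u 0) (u a) = a" "dist (v 0) (v b) = b"
    using isometric_onD[OF assms(1), of 0 a] isometric_onD[OF assms(2), of 0 b] assms by auto
  then show ?thesis
    using assms(5) dist_triangle[of "u 0" "u a" "v b"] dist_triangle[of "u 0" "v b" "u a"]
    by (simp add: dist_commute)
qed

text \<open>Convexity compares \<open>u K\<close> with \<open>v\<close> at the proportional
  parameter \<open>K / r * r'\<close>. Moving that parameter to \<open>K\<close> costs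
  \<open>K / r\<close> times the difference of the lengths, which is again at most
  \<open>K / r\<close> times the distance of the ends; hence the factor 2.\<close>

lemma dist_common_start:
  fixes u v :: "real \<Rightarrow> 'a::busemann_space"
  assumes u: "isometric_on {0..r} u" and v: "isometric_on {0..r'} v" and uv: "u 0 = v 0"
    and K: "0 \<le> K" "K \<le> r" "K \<le> r'" "0 < r"
  shows "dist (u K) (v K) \<le> 2 * (K / r) * dist (u r) (v r')"
proof -
  let ?l = "K / r" and ?D = "dist (u r) (v r')"
  have l: "0 \<le> ?l" "?l \<le> 1" "?l * r = K" using K by auto
  have 1: "dist (u K) (v (?l * r')) \<le> ?l * ?D"
    using geodesic_star_convex[OF u v, of ?l] l K uv by simp
  have lr': "?l * r' \<in> {0..r'}"
    using l K mult_right_mono[of ?l 1 r'] by auto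
  have "dist (v (?l * r')) (v K) = \<bar>?l * r' - ?l * r\<bar>"
    using isometric_onD[OF v lr', of K] K l by simp
  also have "\<dots> = ?l * \<bar>r - r'\<bar>"
    using l by (metis abs_minus_commute abs_mult abs_of_nonneg right_diff_distrib)
  also have "\<dots> \<le> ?l * ?D"
    using geodesic_length_diff[OF u v _ _ uv] K l by (intro mult_left_mono) auto
  finally show ?thesis
    using 1 dist_triangle[of "u K" "v K" "v (?l * r')"] by linarith
qed

text \<open>Proportional parameters and a correction for unequal lengths, as for a common start. The
  bound does not involve the lengths, so it survives when the common end goes to infinity.\<close>

lemma dist_common_end:
  fixes u v :: "real \<Rightarrow> 'a::busemann_space"
  assumes u: "isometric_on {0..l} u" and v: "isometric_on {0..s} v" and uv: "u l = v s"
    and t: "0 \<le> t" "t \<le> l" "t \<le> s"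
  shows "dist (u t) (v t) \<le> 2 * dist (u 0) (v 0)"
proof (cases "l = 0")
  case True
  then have "t = 0" using t by simp
  then show ?thesis by simp
next
  case False
  then have l0: "0 < l" using t by simp
  let ?k = "t / l" and ?D = "dist (u 0) (v 0)"
  have k: "0 \<le> ?k" "?k \<le> 1" "?k * l = t" using t l0 by auto
  have "dist (u t) (v (?k * s)) \<le> (1 - ?k) * ?D"
    using geodesic_convex[OF u v, of ?k] k t uv by simp
  also have "\<dots> \<le> ?D" using k mult_right_mono[of "1 - ?k" 1 ?D] by simp
  finally have 1: "dist (u t) (v (?k * s)) \<le> ?D" .
  have "?k * s \<in> {0..s}" using k t mult_right_mono[of ?k 1 s] by auto
  then have "dist (v (?k * s)) (v t) = \<bar>?k * s - ?k * l\<bar>"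
    using isometric_onD[OF v, of "?k * s" t] k t by simp
  also have "\<dots> = ?k * \<bar>l - s\<bar>"
    using k by (metis abs_minus_commute abs_mult abs_of_nonneg right_diff_distrib)
  also have "\<dots> \<le> \<bar>l - s\<bar>" using k mult_right_mono[of ?k 1 "\<bar>l - s\<bar>"] by simp
  also have "\<dots> \<le> ?D"
    using geodesic_length_diff[OF isometric_on_reflect[OF u] isometric_on_reflect[OF v]] t uv by simp
  finally show ?thesis
    using 1 dist_triangle[of "u t" "v t" "v (?k * s)"] by linarith
qed

section \<open>Chosen segments and concatenation of geodesics\<close>

definition seg :: "'a::geodesic_space \<Rightarrow> 'a \<Rightarrow> real \<Rightarrow> 'a" where
  "seg x y = (SOME \<gamma>. \<gamma> 0 = x \<and> \<gamma> (dist x y) = y \<and> isometric_on {0..dist x y} \<gamma>)"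

lemma seg:
  shows seg_start: "seg x y 0 = x" and seg_finish: "seg x y (dist x y) = y"
    and isometric_seg: "isometric_on {0..dist x y} (seg x y)"
  using someI_ex[OF geodesic_exists[of x y]] by (auto simp: seg_def)

lemma dist_seg:
  assumes "0 \<le> t" "t \<le> dist x y"
  shows "dist x (seg x y t) = t" "dist (seg x y t) y = dist x y - t"
  using isometric_onD[OF isometric_seg, of 0 x y t] isometric_onD[OF isometric_seg, of t x y "dist x y"]
    assms by (auto simp: seg)

text \<open>The total length equals the distance of the outer ends, so the triangle inequality
  leaves no slack between intermediate points.\<close>

lemma isometric_on_concat:
  assumes u: "isometric_on {0..a} u" and v: "isometric_on {0..b} v" and uv: "u a = v 0"
    and ab: "0 \<le> a" "0 \<le> b" and d: "dist (u 0) (v b) = a + b"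
  shows "isometric_on {0..a + b} (\<lambda>t. if t \<le> a then u t else v (t - a))"
proof -
  let ?g = "\<lambda>t. if t \<le> a then u t else v (t - a)"
  have *: "dist (?g s) (?g t) = t - s" if st: "0 \<le> s" "s \<le> t" "t \<le> a + b" for s t
  proof -
    consider "t \<le> a" | "a < s" | "s \<le> a" "a < t" by linarith
    then show ?thesis
    proof cases
      case 1 then show ?thesis using st isometric_onD[OF u, of s t] by auto
    next
      case 2 then show ?thesis using st isometric_onD[OF v, of "s - a" "t - a"] by auto
    next
      case 3
      have "dist (u 0) (u s) = s" "dist (u s) (u a) = a - s"
        "dist (v 0) (v (t - a)) = t - a" "dist (v (t - a)) (v b) = b - (t - a)"
        using 3 st ab isometric_onD[OF u, of 0 s] isometric_onD[OF u, of s a]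
          isometric_onD[OF v, of 0 "t - a"] isometric_onD[OF v, of "t - a" b] by auto
      then show ?thesis
        using 3 d uv dist_triangle[of "u 0" "v b" "u s"] dist_triangle[of "u s" "v b" "v (t - a)"]
          dist_triangle[of "u s" "v (t - a)" "u a"] by auto
    qed
  qed
  show ?thesis
    unfolding isometric_on_def
  proof (intro ballI)
    fix s t assume "s \<in> {0..a + b}" "t \<in> {0..a + b}"
    then show "dist (?g s) (?g t) = \<bar>s - t\<bar>"
      using *[of s t] *[of t s] by (cases "s \<le> t") (auto simp: dist_commute)
  qed
qed

section \<open>Limits of geodesics in proper spaces\<close>

text \<open>Convergence in coordinate \<open>k\<close> is stable under subsequences, and from index
  \<open>Suc k\<close> on the diagonal sequence is a subsequence of one on which that coordinate
  converges.\<close>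

lemma diagonal_subsequence_convergent:
  fixes f :: "nat \<Rightarrow> nat \<Rightarrow> 'a::topological_space"
  assumes C: "\<And>k. seq_compact (C k)" and f: "\<And>n k. f n k \<in> C k"
  obtains r where "strict_mono (r :: nat \<Rightarrow> nat)" "\<And>k. convergent (\<lambda>n. f (r n) k)"
proof -
  interpret subseqs "\<lambda>k r. convergent (\<lambda>n. f (r n) k)"
  proof
    fix k and s :: "nat \<Rightarrow> nat"
    have "\<forall>n. f (s n) k \<in> C k" using f by blast
    then obtain l r where "strict_mono (r :: nat \<Rightarrow> nat)" "((\<lambda>n. f (s n) k) \<circ> r) \<longlonglongrightarrow> l"
      using C[of k] unfolding seq_compact_def by meson
    then show "\<exists>r. strict_mono r \<and> convergent (\<lambda>n. f ((s \<circ> r) n) k)"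
      by (auto simp: convergent_def o_def)
  qed
  show thesis
  proof (rule that[OF subseq_diagseq])
    fix k
    have stable: "convergent (\<lambda>i. f ((s \<circ> r) i) n)"
      if "strict_mono (r :: nat \<Rightarrow> nat)" "convergent (\<lambda>i. f (s i) n)" for r s :: "nat \<Rightarrow> nat" and n
      using convergent_subseq_convergent[OF that(2,1)] by (simp add: o_def)
    have "convergent (\<lambda>n. f ((diagseq \<circ> (+) (Suc k)) n) k)"
      using diagseq_holds[OF stable] .
    then have "convergent (\<lambda>n. f (diagseq (n + Suc k)) k)"
      by (simp only: o_def add.commute)
    then show "convergent (\<lambda>n. f (diagseq n) k)"
      using convergent_ignore_initial_segment[of "\<lambda>n. f (diagseq n) k" "Suc k"] by blast
  qed
qed

text \<open>An Arzela-Ascoli argument: a diagonal subsequence converges on a countable dense subset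
  of \<open>J\<close>, and equicontinuity extends this to all of \<open>J\<close>. The domains
  \<open>I n\<close> vary so that segments of growing length can converge to rays and lines.\<close>

lemma isometric_subsequence_limit:
  fixes u :: "nat \<Rightarrow> real \<Rightarrow> 'a::proper_space"
  assumes iso: "\<And>n. isometric_on (I n) (u n)" and I0: "\<And>n. 0 \<in> I n"
    and J: "\<And>t. t \<in> J \<Longrightarrow> \<forall>\<^sub>F n in sequentially. t \<in> I n"
    and bd: "\<And>n. dist p (u n 0) \<le> R"
  obtains r g where "strict_mono (r :: nat \<Rightarrow> nat)" "isometric_on J g"
    "\<And>t. t \<in> J \<Longrightarrow> (\<lambda>n. u (r n) t) \<longlonglongrightarrow> g t"
proof -
  have ball: "dist p (u n t) \<le> R + \<bar>t\<bar>" if "t \<in> I n" for n t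
    using isometric_onD[OF iso I0 that] bd[of n] dist_triangle[of p "u n t" "u n 0"] by simp
  \<comment> \<open>Outside \<open>I n\<close> the value \<open>u n 0\<close> is a filler that keeps
    \<open>w n t\<close> in a compact ball for every \<open>n\<close>; for \<open>t\<close> in
    \<open>J\<close> it is used only finitely often.\<close>
  define w where "w n t = (if t \<in> I n then u n t else u n 0)" for n t
  have w: "w n t \<in> cball p (R + \<bar>t\<bar>)" for n t
    using ball[of t n] bd[of n] by (auto simp: w_def)
  obtain S where S: "countable S" "S \<subseteq> J" "J \<subseteq> closure S"
    using separable[of J] by metis
  define e where "e = (if S = {} then (\<lambda>_. 0) else from_nat_into S)"
  obtain r where r: "strict_mono (r :: nat \<Rightarrow> nat)"
    and conv: "\<And>k. convergent (\<lambda>n. w (r n) (e k))"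
  proof (rule diagonal_subsequence_convergent[of "\<lambda>k. cball p (R + \<bar>e k\<bar>)" "\<lambda>n k. w n (e k)"])
    show "seq_compact (cball p (R + \<bar>e k\<bar>))" for k
      using compact_cball_proper compact_eq_seq_compact_metric by blast
    show "w n (e k) \<in> cball p (R + \<bar>e k\<bar>)" for n k by (rule w)
  qed blast
  have ev: "\<forall>\<^sub>F n in sequentially. t \<in> I (r n)" if "t \<in> J" for t
    using eventually_subseq[OF r J[OF that]] .
  have convS: "Cauchy (\<lambda>n. w (r n) t)" if t: "t \<in> S" for t
  proof -
    obtain k where "from_nat_into S k = t" using from_nat_into_surj[OF S(1) t] by blast
    then have k: "e k = t" using t by (auto simp: e_def)
    show ?thesis using convergent_Cauchy[OF conv[of k]] unfolding k .
  qed
  have cauchy: "Cauchy (\<lambda>n. w (r n) t)" if t: "t \<in> J" for t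
  proof (rule metric_CauchyI)
    fix \<epsilon> :: real assume "0 < \<epsilon>"
    have "t \<in> closure S" "0 < \<epsilon> / 3" using t S(3) \<open>0 < \<epsilon>\<close> by auto
    then obtain q where q: "q \<in> S" "dist q t < \<epsilon> / 3"
      unfolding closure_approachable by blast
    have "\<forall>\<^sub>F n in sequentially. t \<in> I (r n) \<and> q \<in> I (r n)"
      using ev[OF t] ev[of q] q S(2) by (auto simp: eventually_conj_iff)
    then obtain N where N: "\<And>n. n \<ge> N \<Longrightarrow> t \<in> I (r n) \<and> q \<in> I (r n)"
      by (auto simp: eventually_sequentially)
    obtain M where M: "\<And>m n. m \<ge> M \<Longrightarrow> n \<ge> M \<Longrightarrow> dist (w (r m) q) (w (r n) q) < \<epsilon> / 3"
      using metric_CauchyD[OF convS[OF q(1)], of "\<epsilon> / 3"] \<open>0 < \<epsilon>\<close> by auto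
    have "dist (w (r m) t) (w (r n) t) < \<epsilon>" if mn: "m \<ge> max M N" "n \<ge> max M N" for m n
    proof -
      have "dist (w (r k) t) (w (r k) q) < \<epsilon> / 3" if "k \<ge> N" for k
        using N[OF that] isometric_onD[OF iso, of t "r k" q] q by (auto simp: w_def dist_real_def abs_minus_commute)
      from this[of m] this[of n] M[of m n] mn show ?thesis
        using dist_triangle[of "w (r m) t" "w (r n) t" "w (r m) q"]
          dist_triangle[of "w (r m) q" "w (r n) t" "w (r n) q"] by (auto simp: dist_commute)
    qed
    then show "\<exists>M. \<forall>m\<ge>M. \<forall>n\<ge>M. dist (w (r m) t) (w (r n) t) < \<epsilon>" by blast
  qed
  have "\<exists>l. (\<lambda>n. w (r n) t) \<longlonglongrightarrow> l" if "t \<in> J" for t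
    using compact_imp_complete[OF compact_cball_proper] cauchy[OF that] w[of _ t]
    unfolding complete_def by meson
  then obtain g where g: "\<And>t. t \<in> J \<Longrightarrow> (\<lambda>n. w (r n) t) \<longlonglongrightarrow> g t" by metis
  have lim: "(\<lambda>n. u (r n) t) \<longlonglongrightarrow> g t" if "t \<in> J" for t
  proof (rule Lim_transform_eventually[OF g[OF that]])
    show "\<forall>\<^sub>F n in sequentially. w (r n) t = u (r n) t"
      using ev[OF that] by eventually_elim (simp add: w_def)
  qed
  have "isometric_on J g"
    unfolding isometric_on_def
  proof (intro ballI)
    fix s t assume st: "s \<in> J" "t \<in> J"
    have "(\<lambda>n. dist (u (r n) s) (u (r n) t)) \<longlonglongrightarrow> dist (g s) (g t)"
      using lim st by (intro tendsto_dist) auto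
    moreover have "(\<lambda>n. dist (u (r n) s) (u (r n) t)) \<longlonglongrightarrow> \<bar>s - t\<bar>"
    proof (rule tendsto_eventually)
      show "\<forall>\<^sub>F n in sequentially. dist (u (r n) s) (u (r n) t) = \<bar>s - t\<bar>"
        using ev[OF st(1)] ev[OF st(2)] by eventually_elim (rule isometric_onD[OF iso])
    qed
    ultimately show "dist (g s) (g t) = \<bar>s - t\<bar>" by (rule LIMSEQ_unique)
  qed
  with r lim that show thesis by blast
qed

section \<open>Rays and the boundary\<close>

lemma raysD:
  assumes "c \<in> rays"
  shows "isometric_on {0..} c" "\<And>s t. 0 \<le> s \<Longrightarrow> 0 \<le> t \<Longrightarrow> dist (c s) (c t) = \<bar>s - t\<bar>"
  using assms by (auto simp: rays_def isometric_on_def)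

lemma restrict_in_rays: "isometric_on {0..} c \<Longrightarrow> (\<lambda>t\<in>{0..}. c t) \<in> rays"
  by (auto simp: rays_def isometric_on_def)

lemma rays_eqI: "c \<in> rays \<Longrightarrow> d \<in> rays \<Longrightarrow> (\<And>t. 0 \<le> t \<Longrightarrow> c t = d t) \<Longrightarrow> c = d"
  unfolding rays_def by (auto intro: extensionalityI)

section \<open>Asymptoticity as bounded distance at equal times\<close>

lemma hausdorff_dist_le:
  assumes "\<And>a. a \<in> A \<Longrightarrow> \<exists>b\<in>B. dist a b \<le> M" "\<And>b. b \<in> B \<Longrightarrow> \<exists>a\<in>A. dist a b \<le> M"
  shows "hausdorff_dist A B \<le> ennreal M"
  unfolding hausdorff_dist_def
proof (intro max.boundedI SUP_least)
  fix a assume "a \<in> A"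
  then obtain b where "b \<in> B" "dist a b \<le> M" using assms(1) by blast
  then show "(INF b\<in>B. ennreal (dist a b)) \<le> ennreal M"
    by (intro INF_lower2[of b]) (auto intro: ennreal_leI)
next
  fix b assume "b \<in> B"
  then obtain a where "a \<in> A" "dist a b \<le> M" using assms(2) by blast
  then show "(INF a\<in>A. ennreal (dist a b)) \<le> ennreal M"
    by (intro INF_lower2[of a]) (auto intro: ennreal_leI)
qed

lemma hausdorff_dist_finiteD:
  assumes "hausdorff_dist A B < \<infinity>"
  obtains M where "0 \<le> M" "\<And>a. a \<in> A \<Longrightarrow> \<exists>b\<in>B. dist a b \<le> M"
proof -
  obtain M where M: "0 \<le> M" "hausdorff_dist A B = ennreal M"
    using assms by (cases "hausdorff_dist A B") auto
  show thesis
  \<comment> \<open>The infimum in \<open>hausdorff_dist\<close> need not be attained, so the bound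
    for an actual point is taken strictly above \<open>M\<close>.\<close>
  proof (rule that[of "M + 1"])
    fix a assume a: "a \<in> A"
    have "(INF b\<in>B. ennreal (dist a b)) \<le> (SUP a\<in>A. INF b\<in>B. ennreal (dist a b))"
      using a by (rule SUP_upper)
    also have "\<dots> \<le> hausdorff_dist A B" unfolding hausdorff_dist_def by simp
    also have "\<dots> = ennreal M" by (rule M(2))
    also have "\<dots> < ennreal (M + 1)" using M(1) by (simp add: ennreal_less_iff)
    finally obtain b where "b \<in> B" "ennreal (dist a b) < ennreal (M + 1)"
      by (auto simp: INF_less_iff)
    then show "\<exists>b\<in>B. dist a b \<le> M + 1"
      by (intro bexI[of _ b]) (auto simp: ennreal_less_iff)
  qed (use M in auto)
qed

text \<open>If \<open>d s\<close> is within \<open>M\<close> of \<open>c t\<close>, then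
  \<open>s\<close> and \<open>t\<close>, being distances from the starting points, differ by at most
  \<open>M + dist (c 0) (d 0)\<close>. This turns the Hausdorff bound into a bound at equal
  times.\<close>

lemma asymptotic_iff:
  "(c, d) \<in> asymptotic \<longleftrightarrow> c \<in> rays \<and> d \<in> rays \<and> (\<exists>M. \<forall>t\<ge>0. dist (c t) (d t) \<le> M)"
proof
  assume *: "(c, d) \<in> asymptotic"
  then have cd: "c \<in> rays" "d \<in> rays" by (auto simp: asymptotic_def)
  have "hausdorff_dist (c ` {0..}) (d ` {0..}) < \<infinity>" using * by (auto simp: asymptotic_def)
  then obtain M where M: "0 \<le> M" "\<And>a. a \<in> c ` {0..} \<Longrightarrow> \<exists>b\<in>d ` {0..}. dist a b \<le> M"
    using hausdorff_dist_finiteD by blast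
  have "dist (c t) (d t) \<le> 2 * M + dist (c 0) (d 0)" if t: "0 \<le> t" for t
  proof -
    obtain s where s: "0 \<le> s" "dist (c t) (d s) \<le> M" using M(2)[of "c t"] t by auto
    have "dist (c 0) (c t) = t" "dist (d 0) (d s) = s" "dist (d s) (d t) = \<bar>s - t\<bar>"
      using raysD(2)[OF cd(1), of 0 t] raysD(2)[OF cd(2), of 0 s] raysD(2)[OF cd(2), of s t] s t
      by auto
    then show ?thesis
      using s dist_triangle[of "c t" "d t" "d s"] dist_triangle[of "c 0" "c t" "d s"]
        dist_triangle[of "c 0" "d s" "d 0"] dist_triangle[of "d 0" "d s" "c t"]
        dist_triangle[of "d 0" "c t" "c 0"]
      by (simp add: dist_commute abs_le_iff)
  qed
  then show "c \<in> rays \<and> d \<in> rays \<and> (\<exists>M. \<forall>t\<ge>0. dist (c t) (d t) \<le> M)"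
    using cd by blast
next
  assume *: "c \<in> rays \<and> d \<in> rays \<and> (\<exists>M. \<forall>t\<ge>0. dist (c t) (d t) \<le> M)"
  then obtain M where M: "\<And>t. t \<ge> 0 \<Longrightarrow> dist (c t) (d t) \<le> M" by blast
  have "hausdorff_dist (c ` {0..}) (d ` {0..}) \<le> ennreal M"
    using M by (intro hausdorff_dist_le) auto
  also have "\<dots> < \<infinity>" by simp
  finally show "(c, d) \<in> asymptotic" using * by (simp add: asymptotic_def)
qed

lemma equiv_asymptotic: "equiv (rays :: (real \<Rightarrow> 'a::metric_space) set) asymptotic"
proof (rule equivI)
  show "trans (asymptotic :: ((real \<Rightarrow> 'a) \<times> (real \<Rightarrow> 'a)) set)"
  proof (rule transI)
    fix c d e :: "real \<Rightarrow> 'a"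
    assume cd: "(c, d) \<in> asymptotic" and de: "(d, e) \<in> asymptotic"
    obtain M N where "\<And>t. t \<ge> 0 \<Longrightarrow> dist (c t) (d t) \<le> M" "\<And>t. t \<ge> 0 \<Longrightarrow> dist (d t) (e t) \<le> N"
      using cd de by (auto simp: asymptotic_iff)
    then have "\<forall>t\<ge>0. dist (c t) (e t) \<le> M + N"
      by (meson add_mono dist_triangle order_trans)
    then show "(c, e) \<in> asymptotic" using cd de by (auto simp: asymptotic_iff)
  qed
qed (auto simp: asymptotic_iff refl_on_def sym_def dist_commute)

lemma ray_end_eq: "(c, d) \<in> asymptotic \<Longrightarrow> ray_end c = ray_end d"
  unfolding ray_end_def by (rule equiv_class_eq[OF equiv_asymptotic])

lemma ray_end_in_boundary: "c \<in> rays \<Longrightarrow> ray_end c \<in> geodesic_boundary"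
  by (simp add: ray_end_def geodesic_boundary_def quotientI)

lemma boundary_ray_end:
  assumes "\<xi> \<in> geodesic_boundary" "c \<in> \<xi>"
  shows "c \<in> rays" "ray_end c = \<xi>"
proof -
  obtain d where d: "\<xi> = ray_end d"
    using assms(1) unfolding geodesic_boundary_def ray_end_def by (auto elim: quotientE)
  then have dc: "(d, c) \<in> asymptotic" using assms(2) by (simp add: ray_end_def)
  then show "c \<in> rays" by (simp add: asymptotic_iff)
  show "ray_end c = \<xi>" using ray_end_eq[OF dc] d by simp
qed

section \<open>Uniqueness and existence of the ray from a point in a class\<close>

text \<open>Convexity at a common origin with factor \<open>s / t\<close>. This monotonicity makes
  the limit in \<open>delta\<close> exist.\<close>

lemma ray_divergence_mono:
  fixes c d :: "real \<Rightarrow> 'a::busemann_space"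
  assumes "isometric_on {0..} c" "isometric_on {0..} d" "c 0 = d 0" "0 < s" "s \<le> t"
  shows "dist (c s) (d s) / s \<le> dist (c t) (d t) / t"
proof -
  have "dist (c (s / t * t)) (d (s / t * t)) \<le> s / t * dist (c t) (d t)"
    using assms by (intro geodesic_star_convex) (auto elim!: isometric_on_subset)
  then show ?thesis using assms by (simp add: field_simps)
qed

text \<open>The quotient \<open>dist (c t) (d t) / t\<close> is nondecreasing and its numerator is
  bounded, so it vanishes.\<close>

lemma asymptotic_rays_eq:
  fixes c d :: "real \<Rightarrow> 'a::busemann_space"
  assumes "(c, d) \<in> asymptotic" "c 0 = d 0"
  shows "c = d"
proof -
  obtain M where cd: "c \<in> rays" "d \<in> rays" and M: "\<And>t. t \<ge> 0 \<Longrightarrow> dist (c t) (d t) \<le> M"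
    using assms by (auto simp: asymptotic_iff)
  show ?thesis
  proof (rule rays_eqI[OF cd])
    fix s :: real assume "0 \<le> s"
    show "c s = d s"
    proof (rule ccontr)
      assume ne: "c s \<noteq> d s"
      then have s: "0 < s" using \<open>0 \<le> s\<close> assms(2) by (cases "s = 0") auto
      define q where "q = dist (c s) (d s) / s"
      have q: "0 < q" using ne s by (simp add: q_def)
      define t where "t = max s (M / q + 1)"
      have t: "s \<le> t" "M / q < t" by (auto simp: t_def)
      have "q \<le> dist (c t) (d t) / t"
        unfolding q_def using ray_divergence_mono[OF raysD(1)[OF cd(1)] raysD(1)[OF cd(2)]] assms s t
        by simp
      also have "\<dots> \<le> M / t" using M[of t] s t by (simp add: divide_right_mono)
      finally show False using t q s by (simp add: field_simps)
    qed
  qed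
qed

text \<open>Segments from \<open>p\<close> to \<open>d n\<close> subconverge to a ray from
  \<open>p\<close>. By \<open>dist_common_end\<close> they stay within
  \<open>2 * dist p (d 0)\<close> of \<open>d\<close> at equal times, and so does the limit, which
  puts it in the class of \<open>d\<close>.\<close>

lemma ray_exists:
  fixes p :: "'a::{proper_space, busemann_space}"
  assumes "\<xi> \<in> geodesic_boundary"
  shows "\<exists>c. c \<in> \<xi> \<and> c 0 = p"
proof -
  obtain d where d: "d \<in> rays" "\<xi> = ray_end d"
    using assms unfolding geodesic_boundary_def ray_end_def by (auto elim: quotientE)
  define l where "l n = dist p (d (real n))" for n
  have l: "real n \<le> l n + dist p (d 0)" for n
    using raysD(2)[OF d(1), of 0 "real n"] dist_triangle[of "d 0" "d (real n)" p]
    by (simp add: l_def dist_commute)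
  have ev: "\<forall>\<^sub>F n in sequentially. 0 \<le> t \<longrightarrow> t \<in> {0..l n} \<and> t \<le> real n" for t
  proof -
    have "\<forall>\<^sub>F n in sequentially. real n \<ge> \<bar>t\<bar> + dist p (d 0)"
      using filterlim_real_sequentially by (simp add: filterlim_at_top)
    then show ?thesis
    proof eventually_elim
      case (elim n)
      then show ?case
        unfolding atLeastAtMost_iff using l[of n] zero_le_dist[of p "d 0"] by linarith
    qed
  qed
  have ev': "\<forall>\<^sub>F n in sequentially. t \<in> {0..l n}" if "t \<in> {0..}" for t
    using ev[of t] that by (auto elim: eventually_mono)
  obtain r g where r: "strict_mono (r :: nat \<Rightarrow> nat)" and g: "isometric_on {0..} g"
    and lim: "\<And>t. t \<in> {0..} \<Longrightarrow> (\<lambda>n. seg p (d (real (r n))) t) \<longlonglongrightarrow> g t"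
  proof (rule isometric_subsequence_limit[of "\<lambda>n. {0..l n}" "\<lambda>n. seg p (d (real n))" "{0..}" p 0])
    show "isometric_on {0..l n} (seg p (d (real n)))" for n
      unfolding l_def by (rule isometric_seg)
  qed (use ev' in \<open>auto simp: seg l_def\<close>)
  define c where "c = (\<lambda>t\<in>{0..}. g t)"
  have c: "c \<in> rays" unfolding c_def using restrict_in_rays[OF g] .
  have "dist (d t) (c t) \<le> 2 * dist p (d 0)" if t: "0 \<le> t" for t
  proof -
    have "(\<lambda>n. dist (d t) (seg p (d (real (r n))) t)) \<longlonglongrightarrow> dist (d t) (c t)"
      using lim[of t] t by (intro tendsto_dist tendsto_const) (simp add: c_def)
    moreover have "\<forall>\<^sub>F n in sequentially. dist (d t) (seg p (d (real (r n))) t) \<le> 2 * dist p (d 0)"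
      using eventually_subseq[OF r ev[of t]]
    proof eventually_elim
      case (elim n)
      have "dist (seg p (d (real (r n))) t) (d t) \<le> 2 * dist (seg p (d (real (r n))) 0) (d 0)"
        using elim t raysD(1)[OF d(1)] unfolding l_def
        by (intro dist_common_end[OF isometric_seg]) (auto simp: seg elim!: isometric_on_subset)
      then show ?case by (simp add: seg dist_commute)
    qed
    ultimately show ?thesis by (rule tendsto_upperbound) simp
  qed
  then have "(d, c) \<in> asymptotic" using c d by (auto simp: asymptotic_iff)
  moreover have "c 0 = p"
    using LIMSEQ_unique[OF lim[of 0] ] by (simp add: c_def seg)
  ultimately show ?thesis using d by (auto simp: ray_end_def)
qed

lemma ray_from_ray_end:
  fixes c :: "real \<Rightarrow> 'a::busemann_space"
  assumes "c \<in> rays"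
  shows "ray_from (c 0) (ray_end c) = c"
  unfolding ray_from_def
proof (rule the_equality)
  have "\<forall>t\<ge>0. dist (c t) (c t) \<le> 0" by simp
  then have "(c, c) \<in> asymptotic" using assms unfolding asymptotic_iff by blast
  then show "c \<in> ray_end c \<and> c 0 = c 0" by (simp add: ray_end_def)
  show "d = c" if "d \<in> ray_end c \<and> d 0 = c 0" for d
    using that asymptotic_rays_eq[of c d] by (auto simp: ray_end_def)
qed

lemma ray_from:
  fixes p :: "'a::{proper_space, busemann_space}"
  assumes "\<xi> \<in> geodesic_boundary"
  shows ray_from_start: "ray_from p \<xi> 0 = p" and ray_from_in_rays: "ray_from p \<xi> \<in> rays"
    and ray_end_ray_from: "ray_end (ray_from p \<xi>) = \<xi>"
proof -
  obtain c where c: "c \<in> \<xi>" "c 0 = p" using ray_exists[OF assms] by blast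
  then have "c \<in> rays" "ray_end c = \<xi>" using boundary_ray_end[OF assms] by auto
  with ray_from_ray_end[of c] c have "ray_from p \<xi> = c" by simp
  then show "ray_from p \<xi> 0 = p" "ray_from p \<xi> \<in> rays" "ray_end (ray_from p \<xi>) = \<xi>"
    using c \<open>c \<in> rays\<close> \<open>ray_end c = \<xi>\<close> by auto
qed

section \<open>Divergence rate and cone neighbourhoods\<close>

text \<open>The quotient in \<open>delta\<close> is monotone and at most 1, so it converges to its
  supremum and \<open>Lim\<close> is a true limit. If that limit is at least 1, the quotient
  eventually exceeds \<open>q\<close>.\<close>

lemma not_Td_less_piD:
  fixes p :: "'a::{proper_space, busemann_space}"
  assumes "\<xi> \<in> geodesic_boundary" "\<eta> \<in> geodesic_boundary" "\<not> Td_less_pi p \<xi> \<eta>" "q < 1"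
  shows "\<forall>\<^sub>F t in at_top. dist (ray_from p \<xi> t) (ray_from p \<eta> t) > 2 * t * q"
proof -
  define c d where "c = ray_from p \<xi>" and "d = ray_from p \<eta>"
  have c: "isometric_on {0..} c" and d: "isometric_on {0..} d" and cd: "c 0 = d 0"
    using assms by (simp_all add: c_def d_def ray_from raysD(1))
  define f where "f t = dist (c t) (d t) / (2 * t)" for t
  have mono: "f s \<le> f t" if "0 < s" "s \<le> t" for s t
    using divide_right_mono[OF ray_divergence_mono[OF c d cd that], of 2] by (simp add: f_def mult.commute)
  have bd: "f t \<le> 1" if "0 < t" for t
    using that isometric_onD[OF c, of 0 t] isometric_onD[OF d, of 0 t] cd
      dist_triangle2[of "c t" "d t" "c 0"] by (simp add: f_def dist_commute)
  define L where "L = Sup (f ` {0<..})"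
  have bdd: "bdd_above (f ` {0<..})" using bd by (auto intro!: bdd_aboveI[of _ 1])
  have lim: "(f \<longlongrightarrow> L) at_top"
  proof (rule order_tendstoI)
    fix a assume "a < L"
    then obtain s where s: "0 < s" "a < f s"
      using less_cSUP_iff[OF _ bdd, of a] by (auto simp: L_def)
    show "\<forall>\<^sub>F t in at_top. a < f t"
      using eventually_ge_at_top[of s]
    proof eventually_elim
      case (elim t) then show ?case using mono[of s t] s by linarith
    qed
  next
    fix a assume "L < a"
    show "\<forall>\<^sub>F t in at_top. f t < a"
      using eventually_gt_at_top[of 0]
    proof eventually_elim
      case (elim t)
      then have "f t \<le> L" unfolding L_def by (intro cSUP_upper bdd) auto
      then show ?case using \<open>L < a\<close> by linarith
    qed
  qed
  have "delta p \<xi> \<eta> = L"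
    unfolding delta_def using tendsto_Lim[OF _ lim] by (simp add: f_def[abs_def] c_def d_def)
  then have "q < L" using assms(3,4) by (simp add: Td_less_pi_def)
  have "\<forall>\<^sub>F t in at_top. q < f t" using order_tendstoD(1)[OF lim \<open>q < L\<close>] .
  then have "\<forall>\<^sub>F t in at_top. dist (c t) (d t) > 2 * t * q"
    using eventually_gt_at_top[of 0]
    by eventually_elim (simp add: f_def field_simps)
  then show ?thesis by (simp add: c_def d_def)
qed

text \<open>Passing from radius \<open>K'\<close> to \<open>K\<close> shrinks distances by
  \<open>K / K'\<close>. Neighbourhoods of two boundary points can therefore be given one common
  large radius.\<close>

lemma cone_basic_nbhd_mono:
  fixes p :: "'a::{proper_space, busemann_space}"
  assumes "\<xi> \<in> geodesic_boundary" "0 < K" "K \<le> K'"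
  shows "cone_basic_nbhd p \<xi> K' \<subseteq> cone_basic_nbhd p \<xi> K"
proof
  fix \<eta> assume \<eta>: "\<eta> \<in> cone_basic_nbhd p \<xi> K'"
  define c d where "c = ray_from p \<xi>" and "d = ray_from p \<eta>"
  have \<eta>b: "\<eta> \<in> geodesic_boundary" and less: "dist (c K') (d K') < 1"
    using \<eta> by (auto simp: cone_basic_nbhd_def c_def d_def)
  have "isometric_on {0..} c" "isometric_on {0..} d" "c 0 = d 0"
    using assms \<eta>b by (simp_all add: c_def d_def ray_from raysD(1))
  from ray_divergence_mono[OF this assms(2,3)]
  have "dist (c K) (d K) \<le> K / K' * dist (c K') (d K')"
    using assms by (simp add: field_simps)
  also have "\<dots> \<le> 1 * dist (c K') (d K')"
    using assms by (intro mult_right_mono) auto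
  finally show "\<eta> \<in> cone_basic_nbhd p \<xi> K"
    using less \<eta>b by (simp add: cone_basic_nbhd_def c_def d_def)
qed

section \<open>Joining two boundary points\<close>

text \<open>Divergence at rate at least \<open>q\<close> at radius \<open>T\<close> persists up to
  the shorter length. Convexity of the distance to the end of the shorter geodesic, taken along the
  longer one, then carries it to both ends. For \<open>q\<close> near 1 the path through the origin
  is almost shortest.\<close>

lemma dist_geodesics_lower_bound:
  fixes u v :: "real \<Rightarrow> 'a::busemann_space"
  assumes u: "isometric_on {0..a} u" and v: "isometric_on {0..b} v" and uv: "u 0 = v 0"
    and T: "0 < T" "T \<le> a" "T \<le> b" "2 * T * q \<le> dist (u T) (v T)"
  shows "a + b - 2 * (1 - q) * max a b \<le> dist (u a) (v b)"
proof -
  have *: "a + b - 2 * (1 - q) * a \<le> dist (u a) (v b)"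
    if u: "isometric_on {0..a} u" and v: "isometric_on {0..b} v" and uv: "u 0 = v 0"
      and T: "0 < T" "T \<le> b" "b \<le> a" "2 * T * q \<le> dist (u T) (v T)"
    for u v :: "real \<Rightarrow> 'a" and a b
  proof -
    have ab: "0 < b" "0 < a" using T by auto
    have "dist (u (T / b * b)) (v (T / b * b)) \<le> T / b * dist (u b) (v b)"
      using T ab uv by (intro geodesic_star_convex isometric_on_subset[OF u] isometric_on_subset[OF v]) auto
    then have "2 * T * q \<le> T / b * dist (u b) (v b)" using T ab by simp
    then have 1: "2 * b * q \<le> dist (u b) (v b)" using T ab by (simp add: field_simps)
    \<comment> \<open>A constant map is a degenerate geodesic; it turns
      \<open>geodesic_convex\<close> into convexity of the distance to the point
      \<open>v b\<close>.\<close>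
    have w: "isometric_on {0..0} (\<lambda>_. v b)" by (simp add: isometric_on_def)
    have "dist (u (b / a * a)) (v b) \<le> (1 - b / a) * dist (u 0) (v b) + b / a * dist (u a) (v b)"
      using geodesic_convex[OF u w, of "b / a"] T ab by simp
    moreover have "dist (u 0) (v b) = b" using isometric_onD[OF v, of 0 b] uv ab by simp
    ultimately have "2 * b * q \<le> (1 - b / a) * b + b / a * dist (u a) (v b)" using 1 ab by simp
    also have "\<dots> = b * ((1 - b / a) + dist (u a) (v b) / a)" by (simp add: field_simps)
    finally have "a * (2 * q) \<le> a * ((1 - b / a) + dist (u a) (v b) / a)" using ab by simp
    also have "\<dots> = a - b + dist (u a) (v b)" using ab by (simp add: algebra_simps)
    finally show ?thesis by (simp add: algebra_simps)
  qed
  show ?thesis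
  proof (cases "b \<le> a")
    case True
    then show ?thesis using *[OF u v uv] T by (simp add: max_def)
  next
    case False
    then show ?thesis using *[OF v u uv[symmetric]] T by (simp add: max_def dist_commute add.commute)
  qed
qed

lemma point_on_ray:
  fixes c :: "real \<Rightarrow> 'a::{proper_space, busemann_space}"
  assumes c: "isometric_on {0..} c" and K: "0 < K" "dist (c 0) w = K"
    and s: "filterlim s at_top sequentially"
    and lim: "\<And>e. 0 < e \<Longrightarrow> \<forall>\<^sub>F n in sequentially. dist w (c (s n)) \<le> s n - K + e"
  shows "w = c K"
proof -
  txt \<open>A limit \<open>l\<close> of points at distance \<open>\<sigma>\<close> from \<open>w\<close> towards \<open>c (s n)\<close> stays within \<open>3 * K\<close> of
    \<open>c (K + \<sigma>)\<close>, and \<open>w\<close> lies on a geodesic from \<open>c 0\<close> to \<open>l\<close>; convexity then shrinks the distance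
    at radius \<open>K\<close> by the factor \<open>K / (K + \<sigma>)\<close>.\<close>
  have bound: "dist w (c K) \<le> 6 * K * K / (K + \<sigma>)" if \<sigma>: "0 < \<sigma>" for \<sigma>
  proof -
    define q where "q n = seg w (c (s n)) \<sigma>" for n
    have len: "s n - K \<le> dist w (c (s n))" if "0 \<le> s n" for n
      using that K isometric_onD[OF c, of 0 "s n"] dist_triangle[of "c 0" "c (s n)" w] by auto
    have "\<forall>\<^sub>F n in sequentially. s n \<ge> K + \<sigma>"
      using s by (simp add: filterlim_at_top)
    then obtain N where N: "\<And>n. n \<ge> N \<Longrightarrow> s n \<ge> K + \<sigma>"
      by (auto simp: eventually_sequentially)
    have wq: "dist w (q n) = \<sigma>" and qc: "dist (q n) (c (s n)) = dist w (c (s n)) - \<sigma>"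
      if "n \<ge> N" for n
      using len[of n] N[OF that] \<sigma> K by (auto simp: q_def dist_seg)
    have "seq_compact (cball w \<sigma>)"
      using compact_cball_proper compact_eq_seq_compact_metric by blast
    moreover have "\<forall>n. q (n + N) \<in> cball w \<sigma>" using wq by simp
    ultimately obtain l r where r: "strict_mono (r :: nat \<Rightarrow> nat)"
      and "((\<lambda>n. q (n + N)) \<circ> r) \<longlonglongrightarrow> l"
      unfolding seq_compact_def by meson
    then have l: "(\<lambda>n. q (r n + N)) \<longlonglongrightarrow> l" by (simp add: o_def)
    have wl: "dist w l = \<sigma>"
      using LIMSEQ_unique[OF tendsto_dist[OF tendsto_const l, of w]] wq by simp
    \<comment> \<open>For large indices \<open>q n\<close> is at distance at most
      \<open>s n - K - \<sigma> + e\<close> from \<open>c (s n)\<close>, hence at least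
      \<open>K + \<sigma> - e\<close> from \<open>c 0\<close>. Letting \<open>e\<close> tend to 0
      shows that the path from \<open>c 0\<close> through \<open>w\<close> to \<open>l\<close> is
      geodesic.\<close>
    have "K + \<sigma> - e \<le> dist (c 0) l" if e: "0 < e" for e
    proof (rule tendsto_lowerbound[OF tendsto_dist[OF tendsto_const l]])
      have rN: "strict_mono (\<lambda>n. r n + N)" using r by (simp add: strict_mono_def)
      show "\<forall>\<^sub>F n in sequentially. K + \<sigma> - e \<le> dist (c 0) (q (r n + N))"
        using eventually_subseq[OF rN lim[OF e]]
      proof eventually_elim
        case (elim n)
        have "dist (c 0) (c (s (r n + N))) = s (r n + N)"
          using isometric_onD[OF c, of 0 "s (r n + N)"] N[of "r n + N"] K \<sigma> by simp
        then show ?case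
          using elim qc[of "r n + N"] dist_triangle[of "c 0" "c (s (r n + N))" "q (r n + N)"] by simp
      qed
    qed simp
    then have "K + \<sigma> \<le> dist (c 0) l + e" if "0 < e" for e using that by (simp add: diff_le_eq)
    then have "K + \<sigma> \<le> dist (c 0) l" by (rule field_le_epsilon)
    then have pl: "dist (c 0) l = K + \<sigma>"
      using dist_triangle[of "c 0" l w] wl K by simp
    have "dist (q n) (c \<sigma>) \<le> 2 * K" if n: "n \<ge> N" for n
    proof -
      have "dist (seg w (c (s n)) \<sigma>) (c \<sigma>) \<le> 2 * dist (seg w (c (s n)) 0) (c 0)"
        using N[OF n] len[of n] \<sigma> K(1) c
        by (intro dist_common_end[OF isometric_seg]) (auto simp: seg elim!: isometric_on_subset)
      then show ?thesis using K by (simp add: q_def seg dist_commute)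
    qed
    then have "dist l (c \<sigma>) \<le> 2 * K"
      by (intro tendsto_upperbound[OF tendsto_dist[OF l tendsto_const]]) auto
    moreover have "dist (c \<sigma>) (c (K + \<sigma>)) = K"
      using isometric_onD[OF c, of \<sigma> "K + \<sigma>"] \<sigma> K by simp
    ultimately have lc: "dist l (c (K + \<sigma>)) \<le> 3 * K"
      using dist_triangle[of l "c (K + \<sigma>)" "c \<sigma>"] by simp
    define g where "g t = (if t \<le> K then seg (c 0) w t else seg w l (t - K))" for t
    have "isometric_on {0..K + \<sigma>} g"
      unfolding g_def
      using K isometric_seg[of "c 0" w] isometric_seg[of w l] seg_finish[of "c 0" w]
        seg_finish[of w l] wl pl \<sigma>
      by (intro isometric_on_concat) (auto simp: seg)
    moreover have g: "g 0 = c 0" "g K = w" "g (K + \<sigma>) = l"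
      using K \<sigma> seg_finish[of "c 0" w] seg_finish[of w l] wl by (auto simp: g_def seg)
    ultimately have "dist (g K) (c K) \<le> 2 * (K / (K + \<sigma>)) * dist (g (K + \<sigma>)) (c (K + \<sigma>))"
      using K(1) \<sigma> c g
      by (intro dist_common_start) (auto elim!: isometric_on_subset)
    also have "\<dots> = 2 * (K / (K + \<sigma>)) * dist l (c (K + \<sigma>))"
      using g by simp
    also have "2 * (K / (K + \<sigma>)) * dist l (c (K + \<sigma>)) \<le> 2 * (K / (K + \<sigma>)) * (3 * K)"
      using lc K \<sigma> by (intro mult_left_mono) auto
    finally show ?thesis using g by simp
  qed
  have lim0: "((\<lambda>\<sigma>. 6 * K * K / (K + \<sigma>)) \<longlongrightarrow> 0) at_top"
    by (intro tendsto_divide_0[OF tendsto_const] filterlim_at_top_imp_at_infinity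
        filterlim_tendsto_add_at_top[OF tendsto_const] filterlim_ident)
  have "dist w (c K) \<le> 0"
    using tendsto_lowerbound[OF lim0 eventually_mono[OF eventually_gt_at_top[of 0] bound]] by simp
  then show ?thesis by simp
qed

section \<open>Segments that return to a fixed ball\<close>

text \<open>Parameterized with time 0 at a point of the ball, these geodesics subconverge to a line.
  By \<open>dist_common_end\<close> both halves stay within \<open>2 * R\<close> of \<open>c\<close>
  and \<open>d\<close>, which identifies the ends of the limit.\<close>

lemma geodesic_line_between:
  fixes c d :: "real \<Rightarrow> 'a::{proper_space, busemann_space}"
  assumes c: "c \<in> rays" and d: "d \<in> rays" and cd: "c 0 = d 0"
    and freq: "\<exists>\<^sub>F n in sequentially. \<exists>z. dist (c 0) z \<le> R \<and>
      dist (c (real n)) z + dist z (d (real n)) = dist (c (real n)) (d (real n))"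
  shows "\<exists>a. geodesic_line a \<and> end_neg a = ray_end c \<and> end_pos a = ray_end d"
proof -
  have "\<exists>n z. n \<ge> N \<and> dist (c 0) z \<le> R \<and>
      dist (c (real n)) z + dist z (d (real n)) = dist (c (real n)) (d (real n))" for N
    using freq unfolding frequently_sequentially by auto
  then obtain m z where m: "\<And>N. m N \<ge> N" and z: "\<And>N. dist (c 0) (z N) \<le> R"
    and split: "\<And>N. dist (c (real (m N))) (z N) + dist (z N) (d (real (m N))) =
      dist (c (real (m N))) (d (real (m N)))"
    by metis
  define l where "l N = dist (c (real (m N))) (z N)" for N
  define h where "h N = dist (z N) (d (real (m N)))" for N
  \<comment> \<open>Assembled from two segments, the geodesic passes through \<open>z N\<close> at
    time \<open>l N\<close> by construction; \<open>u\<close> below moves that time to 0.\<close>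
  define f where "f N t = (if t \<le> l N then seg (c (real (m N))) (z N) t
    else seg (z N) (d (real (m N))) (t - l N))" for N t
  have lh: "l N \<ge> real N - R" "h N \<ge> real N - R" "l N \<ge> 0" "h N \<ge> 0" for N
    using raysD(2)[OF c, of 0 "real (m N)"] raysD(2)[OF d, of 0 "real (m N)"] m[of N] z[of N] cd
      dist_triangle[of "c 0" "c (real (m N))" "z N"] dist_triangle[of "c 0" "d (real (m N))" "z N"]
    by (auto simp: l_def h_def dist_commute)
  have f: "isometric_on {0..l N + h N} (f N)" for N
    unfolding f_def using isometric_seg[of "c (real (m N))" "z N"] seg_finish[of "c (real (m N))" "z N"]
      isometric_seg[of "z N" "d (real (m N))"] seg_finish[of "z N" "d (real (m N))"] lh[of N] split[of N]
    by (intro isometric_on_concat) (auto simp: seg l_def h_def)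
  have f0: "f N 0 = c (real (m N))" "f N (l N) = z N" "f N (l N + h N) = d (real (m N))" for N
    using lh[of N] seg_finish[of "c (real (m N))" "z N"] seg_finish[of "z N" "d (real (m N))"]
    by (auto simp: f_def seg l_def h_def)
  define u where "u N t = f N (l N + t)" for N t
  have u: "isometric_on {- l N..h N} (u N)" for N
    using isometric_on_shift[OF f[of N], of "l N"] by (simp add: u_def[abs_def])
  have ev: "\<forall>\<^sub>F N in sequentially. \<bar>t\<bar> \<le> l N \<and> \<bar>t\<bar> \<le> h N \<and> \<bar>t\<bar> \<le> real (m N)" for t
  proof -
    have "\<forall>\<^sub>F n in sequentially. real n \<ge> \<bar>t\<bar> + \<bar>R\<bar>"
      using filterlim_real_sequentially by (simp add: filterlim_at_top)
    then show ?thesis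
    proof eventually_elim
      case (elim n) then show ?case using lh(1,2)[of n] m[of n] by linarith
    qed
  qed
  have ev': "\<forall>\<^sub>F N in sequentially. t \<in> {- l N..h N}" for t
    using ev[of t] by eventually_elim auto
  obtain r a where r: "strict_mono (r :: nat \<Rightarrow> nat)" and a: "isometric_on UNIV a"
    and lim: "\<And>t. t \<in> UNIV \<Longrightarrow> (\<lambda>n. u (r n) t) \<longlonglongrightarrow> a t"
  proof (rule isometric_subsequence_limit[of "\<lambda>N. {- l N..h N}" u UNIV "c 0" R])
    show "dist (c 0) (u n 0) \<le> R" for n using z by (simp add: u_def f0)
  qed (use u ev' lh in auto)
  have u_pos: "isometric_on {0..h N} (u N)" for N
    using u[of N] by (rule isometric_on_subset) (use lh in auto)
  have u0: "u N 0 = z N" "u N (h N) = d (real (m N))" "u N (- l N) = c (real (m N))" for N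
    by (simp_all add: u_def f0)
  have pos: "dist (u N t) (d t) \<le> 2 * R" if "0 \<le> t" "t \<le> h N" "t \<le> real (m N)" for N t
  proof -
    have "dist (u N t) (d t) \<le> 2 * dist (u N 0) (d 0)"
      using that raysD(1)[OF d] u0
      by (intro dist_common_end[OF u_pos, of "real (m N)"]) (auto elim!: isometric_on_subset)
    then show ?thesis using z[of N] cd u0 by (simp add: dist_commute)
  qed
  have neg: "dist (u N (- t)) (c t) \<le> 2 * R" if "0 \<le> t" "t \<le> l N" "t \<le> real (m N)" for N t
  proof -
    have "isometric_on {0..l N} (\<lambda>t. u N (- t))"
      using u[of N] lh[of N] by (auto simp: isometric_on_def)
    then have "dist (u N (- t)) (c t) \<le> 2 * dist (u N (- 0)) (c 0)"
      using that raysD(1)[OF c] u0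
      by (intro dist_common_end[of "l N" "\<lambda>t. u N (- t)" "real (m N)"])
        (auto elim!: isometric_on_subset)
    then show ?thesis using z[of N] u0 by (simp add: dist_commute)
  qed
  have "dist (a t) (d t) \<le> 2 * R" if t: "0 \<le> t" for t
  proof (rule tendsto_upperbound[OF tendsto_dist[OF lim tendsto_const]])
    show "\<forall>\<^sub>F n in sequentially. dist (u (r n) t) (d t) \<le> 2 * R"
      using eventually_subseq[OF r ev[of t]] by eventually_elim (use pos t in auto)
  qed auto
  moreover have "(\<lambda>t\<in>{0..}. a t) \<in> rays"
    using a by (intro restrict_in_rays) (auto elim: isometric_on_subset)
  ultimately have "((\<lambda>t\<in>{0..}. a t), d) \<in> asymptotic"
    using d by (auto simp: asymptotic_iff)
  moreover have "dist (a (- t)) (c t) \<le> 2 * R" if t: "0 \<le> t" for t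
  proof (rule tendsto_upperbound[OF tendsto_dist[OF lim tendsto_const]])
    show "\<forall>\<^sub>F n in sequentially. dist (u (r n) (- t)) (c t) \<le> 2 * R"
      using eventually_subseq[OF r ev[of t]] by eventually_elim (use neg t in auto)
  qed auto
  moreover have "(\<lambda>t\<in>{0..}. a (- t)) \<in> rays"
    using a by (intro restrict_in_rays) (auto simp: isometric_on_def)
  ultimately have "((\<lambda>t\<in>{0..}. a (- t)), c) \<in> asymptotic"
    using c by (auto simp: asymptotic_iff)
  with a show ?thesis
    using \<open>((\<lambda>t\<in>{0..}. a t), d) \<in> asymptotic\<close> ray_end_eq
    by (auto simp: geodesic_line_def end_pos_def end_neg_def)
qed

section \<open>Shadows at radius \<open>K\<close> of segments that escape to infinity\<close>

text \<open>When the ends coincide, the bound of \<open>dist_common_start\<close> is 0.\<close>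

lemma seg_eq_ray:
  fixes c :: "real \<Rightarrow> 'a::busemann_space"
  assumes c: "isometric_on {0..} c" and "0 \<le> t" "t \<le> s"
  shows "seg (c 0) (c s) t = c t"
proof (cases "s = 0")
  case False
  have s: "dist (c 0) (c s) = s" using isometric_onD[OF c, of 0 s] assms by simp
  have "dist (seg (c 0) (c s) t) (c t) \<le> 2 * (t / s) * dist (seg (c 0) (c s) s) (c s)"
    using isometric_seg[of "c 0" "c s"] c assms s False
    by (intro dist_common_start) (auto simp: seg elim!: isometric_on_subset)
  then show ?thesis using seg_finish[of "c 0" "c s"] s by simp
qed (use assms seg_start in auto)

text \<open>\<open>seg p w K\<close> is the shadow of \<open>w\<close> on the sphere of radius
  \<open>K\<close> about \<open>p\<close>. Its continuity in \<open>w\<close> feeds the intermediate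
  value argument in \<open>escaping_segment_points\<close>.\<close>

lemma shadow_lipschitz:
  fixes p :: "'a::busemann_space"
  assumes "0 < K" "K \<le> dist p w" "K \<le> dist p w'"
  shows "dist (seg p w K) (seg p w' K) \<le> 2 * dist w w'"
proof -
  have "dist (seg p w K) (seg p w' K)
      \<le> 2 * (K / dist p w) * dist (seg p w (dist p w)) (seg p w' (dist p w'))"
    using assms by (intro dist_common_start isometric_seg) (auto simp: seg)
  also have "\<dots> \<le> 2 * 1 * dist w w'"
    unfolding seg_finish using assms by (intro mult_right_mono mult_left_mono) (auto simp: divide_le_eq_1)
  finally show ?thesis by simp
qed

text \<open>With \<open>R = dist (c 0) (\<tau> 0)\<close>, convexity keeps \<open>\<tau> t\<close>
  within \<open>R\<close> of a point of \<open>c\<close>, while \<open>\<tau> t\<close> is at least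
  \<open>(4 * K + 1) * R\<close> away from \<open>c 0\<close>. Shrinking to radius \<open>K\<close>
  leaves at most \<open>2 * K / (4 * K + 1)\<close>, which is below \<open>1 / 2\<close>.\<close>

lemma shadow_near_end:
  fixes c \<tau> :: "real \<Rightarrow> 'a::busemann_space"
  assumes c: "isometric_on {0..} c" and s: "0 \<le> s"
    and \<tau>: "isometric_on {0..l} \<tau>" "\<tau> l = c s"
    and K: "1 \<le> K" "K \<le> dist (c 0) (\<tau> 0)"
    and t: "(4 * K + 2) * dist (c 0) (\<tau> 0) \<le> t" "t \<le> l"
  shows "dist (seg (c 0) (\<tau> t) K) (c K) < 1 / 2"
proof -
  let ?p = "c 0" and ?R = "dist (c 0) (\<tau> 0)"
  have R: "1 \<le> ?R" using K by simp
  have KR: "K \<le> K * ?R" using mult_left_mono[OF R, of K] K by simp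
  have "2 * 1 \<le> (4 * K + 2) * ?R" using K R by (intro mult_mono) auto
  then have tl: "0 < t" "0 < l" using t by linarith+
  define k where "k = t / l"
  have k: "0 \<le> k" "k \<le> 1" "k * l = t" using tl t by (auto simp: k_def)
  have cs: "isometric_on {0..s} c" using c by (rule isometric_on_subset) auto
  have "dist (\<tau> t) (c (k * s)) \<le> (1 - k) * dist (\<tau> 0) ?p"
    using geodesic_convex[OF \<tau>(1) cs, of k] tl s k \<tau>(2) by simp
  also have "\<dots> \<le> ?R"
    using mult_right_mono[of "1 - k" 1 ?R] k by (simp add: dist_commute)
  finally have near: "dist (\<tau> t) (c (k * s)) \<le> ?R" .
  define r where "r = dist ?p (\<tau> t)"
  have "dist (\<tau> 0) (\<tau> t) = t" using isometric_onD[OF \<tau>(1), of 0 t] t tl by simp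
  then have "t - ?R \<le> r"
    using dist_triangle[of "\<tau> 0" "\<tau> t" ?p] by (simp add: r_def dist_commute)
  then have r: "(4 * K + 1) * ?R \<le> r" using t by (simp add: algebra_simps)
  have ks: "0 \<le> k * s" using k s by simp
  have "dist ?p (c (k * s)) = k * s" using isometric_onD[OF c, of 0 "k * s"] ks by simp
  then have "r - ?R \<le> k * s"
    using near dist_triangle[of ?p "\<tau> t" "c (k * s)"] by (simp add: r_def dist_commute)
  moreover have "4 * (K * ?R) + ?R \<le> r" using r by (simp add: algebra_simps)
  ultimately have Kks: "K \<le> k * s" "K \<le> r" using KR K R by linarith+
  have r0: "0 < r" using Kks K by simp
  have "dist (seg ?p (\<tau> t) K) (c K) \<le> 2 * (K / r) * dist (seg ?p (\<tau> t) r) (c (k * s))"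
    unfolding r_def using Kks K c isometric_seg[of ?p "\<tau> t"]
    by (intro dist_common_start) (auto simp: seg r_def elim!: isometric_on_subset)
  also have "seg ?p (\<tau> t) r = \<tau> t" by (simp add: r_def seg_finish)
  also have "2 * (K / r) * dist (\<tau> t) (c (k * s)) \<le> 2 * (K / r) * ?R"
    using near K r0 by (intro mult_left_mono) auto
  also have "\<dots> < 1 / 2"
    using r r0 R by (simp add: field_simps)
  finally show ?thesis .
qed

text \<open>The shadow of the segment starts at \<open>c K\<close> and at time \<open>b\<close> is
  within \<open>1 / 2\<close> of \<open>d K\<close>, hence at least \<open>1 / 2\<close> from
  \<open>c K\<close>. The intermediate value theorem yields \<open>x\<close>, and \<open>y\<close>
  is the point at time \<open>b\<close>. Both times are within \<open>(4 * K + 2) * R\<close> of the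
  nearest time \<open>m\<close>, which gives the upper bounds on the distances.\<close>

lemma escaping_segment_points:
  fixes c d \<sigma> :: "real \<Rightarrow> 'a::busemann_space"
  assumes c: "isometric_on {0..} c" and d: "isometric_on {0..} d" and cd: "c 0 = d 0"
    and s: "0 \<le> s" and \<sigma>: "isometric_on {0..L} \<sigma>" "\<sigma> 0 = c s" "\<sigma> L = d s"
    and K: "1 \<le> K" "1 < dist (c K) (d K)"
    and m: "m \<in> {0..L}" and R: "R = dist (c 0) (\<sigma> m)" "K \<le> R"
    and nearest: "\<And>t. t \<in> {0..L} \<Longrightarrow> R \<le> dist (c 0) (\<sigma> t)"
  shows "\<exists>x y. dist (c s) y = dist (c s) x + dist x y \<and>
    dist (c 0) x \<in> {R..(4 * K + 3) * R} \<and> dist (c 0) y \<in> {R..(4 * K + 3) * R} \<and>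
    dist (seg (c 0) x K) (c K) = 1 / 2 \<and> dist (seg (c 0) y K) (d K) \<le> 1 / 2"
proof -
  let ?p = "c 0" and ?C = "4 * K + 2"
  have CR: "0 \<le> ?C * R" using K R by simp
  \<comment> \<open>At \<open>?C * R\<close> past the nearest point the shadow is already close to
    \<open>d K\<close>; if the segment stops earlier, its end \<open>d s\<close> serves
    instead.\<close>
  define b where "b = min L (m + ?C * R)"
  have b: "m \<le> b" "b \<le> L" "0 \<le> b" "b \<le> m + ?C * R" using m CR by (auto simp: b_def)
  define f where "f t = dist (seg ?p (\<sigma> t) K) (c K)" for t
  have Ls: "K \<le> s"
    using nearest[of 0] m \<sigma>(2) R isometric_onD[OF c, of 0 s] s by auto
  have yV: "dist (seg ?p (\<sigma> b) K) (d K) \<le> 1 / 2"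
  proof (cases "b = L")
    case True
    then show ?thesis using seg_eq_ray[OF d, of K s] Ls K \<sigma> cd by simp
  next
    case False
    then have b': "b = m + ?C * R" by (auto simp: b_def min_def)
    have "isometric_on {0..L - m} (\<lambda>t. \<sigma> (m + t))"
      using \<sigma>(1) m by (auto simp: isometric_on_def)
    then have "dist (seg (d 0) (\<sigma> (m + ?C * R)) K) (d K) < 1 / 2"
      using b b' \<sigma> K R cd s by (intro shadow_near_end[OF d, of s "L - m"]) auto
    then show ?thesis using b' cd by simp
  qed
  have "continuous_on {0..b} f"
  proof (rule lipschitz_on_continuous_on[of 2], rule lipschitz_onI)
    fix t t' assume t: "t \<in> {0..b}" "t' \<in> {0..b}"
    have "dist (seg ?p (\<sigma> t) K) (seg ?p (\<sigma> t') K) \<le> 2 * dist (\<sigma> t) (\<sigma> t')"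
      using nearest[of t] nearest[of t'] t b R K by (intro shadow_lipschitz) auto
    moreover have "dist (\<sigma> t) (\<sigma> t') = dist t t'"
      using isometric_onD[OF \<sigma>(1), of t t'] t b by (auto simp: dist_real_def)
    ultimately show "dist (f t) (f t') \<le> 2 * dist t t'"
      unfolding f_def dist_real_def
      using dist_triangle[of "seg ?p (\<sigma> t) K" "c K" "seg ?p (\<sigma> t') K"]
        dist_triangle[of "seg ?p (\<sigma> t') K" "c K" "seg ?p (\<sigma> t) K"]
      by (simp add: dist_commute abs_le_iff)
  qed simp
  moreover have "f 0 \<le> 1 / 2"
    using seg_eq_ray[OF c, of K s] Ls K \<sigma> by (simp add: f_def)
  moreover have "1 / 2 \<le> f b"
    using yV K dist_triangle2[of "c K" "d K" "seg ?p (\<sigma> b) K"]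
    by (simp add: f_def dist_commute)
  ultimately obtain a where a: "0 \<le> a" "a \<le> b" "f a = 1 / 2"
    using IVT'[of f 0 "1 / 2" b] b by auto
  \<comment> \<open>At an earlier time, \<open>shadow_near_end\<close> for the reversed segment
    would put the shadow strictly within \<open>1 / 2\<close> of \<open>c K\<close>.\<close>
  have "m - ?C * R \<le> a"
  proof (rule ccontr)
    assume "\<not> m - ?C * R \<le> a"
    moreover have "isometric_on {0..m} (\<lambda>t. \<sigma> (m - t))"
      using \<sigma>(1) m by (auto simp: isometric_on_def)
    ultimately have "dist (seg ?p (\<sigma> (m - (m - a))) K) (c K) < 1 / 2"
      using m a \<sigma> K R s by (intro shadow_near_end[OF c, of s m]) auto
    then show False using a by (simp add: f_def)
  qed
  have up: "dist ?p (\<sigma> t) \<le> (4 * K + 3) * R" if "t \<in> {0..L}" "\<bar>m - t\<bar> \<le> ?C * R" for t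
    using isometric_onD[OF \<sigma>(1) m that(1)] that R dist_triangle[of ?p "\<sigma> t" "\<sigma> m"]
    by (simp add: algebra_simps)
  show ?thesis
  proof (intro exI conjI)
    show "dist (c s) (\<sigma> b) = dist (c s) (\<sigma> a) + dist (\<sigma> a) (\<sigma> b)"
      using isometric_onD[OF \<sigma>(1), of 0 b] isometric_onD[OF \<sigma>(1), of 0 a]
        isometric_onD[OF \<sigma>(1), of a b] a b \<sigma>(2) by auto
    show "dist ?p (\<sigma> a) \<in> {R..(4 * K + 3) * R}"
      using nearest[of a] up[of a] \<open>m - ?C * R \<le> a\<close> a b by (auto simp: abs_le_iff)
    show "dist ?p (\<sigma> b) \<in> {R..(4 * K + 3) * R}"
      using nearest[of b] up[of b] b by (auto simp: abs_le_iff)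
  qed (use a yV in \<open>auto simp: f_def\<close>)
qed

text \<open>Otherwise the segments escape, and the points from
  \<open>escaping_segment_points\<close> have limit directions \<open>g\<close> and \<open>h\<close>
  within \<open>1 / 2\<close> of \<open>c\<close> and \<open>d\<close> at radius \<open>K\<close>.
  Then \<open>U\<close> excludes \<open>delta\<close> below 1 for them, which forces
  \<open>g K = c K\<close>, although these points are exactly \<open>1 / 2\<close> apart.\<close>

lemma frequently_segment_near:
  fixes c d :: "real \<Rightarrow> 'a::{proper_space, busemann_space}"
  assumes c: "c \<in> rays" and d: "d \<in> rays" and cd: "c 0 = d 0"
    and K: "1 \<le> K" "1 < dist (c K) (d K)"
    and U: "\<And>c' d'. \<lbrakk>c' \<in> rays; d' \<in> rays; c' 0 = c 0; d' 0 = c 0; dist (c K) (c' K) < 1;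
      dist (d K) (d' K) < 1\<rbrakk> \<Longrightarrow> \<not> Td_less_pi (c 0) (ray_end c') (ray_end d')"
  shows "\<exists>R. \<exists>\<^sub>F n in sequentially. \<exists>z. dist (c 0) z \<le> R \<and>
      dist (c (real n)) z + dist z (d (real n)) = dist (c (real n)) (d (real n))"
proof (rule ccontr)
  assume "\<not> ?thesis"
  then have none: "\<forall>\<^sub>F n in sequentially. \<not> (\<exists>z. dist (c 0) z \<le> R \<and>
      dist (c (real n)) z + dist z (d (real n)) = dist (c (real n)) (d (real n)))" for R
    unfolding not_frequently[symmetric] by blast
  have far: "\<forall>\<^sub>F n in sequentially. \<forall>z. dist (c (real n)) z + dist z (d (real n)) =
      dist (c (real n)) (d (real n)) \<longrightarrow> R < dist (c 0) z" for R
    using none[of R] by eventually_elim (meson not_le)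
  let ?p = "c 0"
  define C where "C = 4 * K + 3"
  have C0: "0 < C" using K by (simp add: C_def)
  define L where "L n = dist (c (real n)) (d (real n))" for n
  define \<sigma> where "\<sigma> n = seg (c (real n)) (d (real n))" for n
  have \<sigma>: "isometric_on {0..L n} (\<sigma> n)" "\<sigma> n 0 = c (real n)" "\<sigma> n (L n) = d (real n)" for n
    by (auto simp: \<sigma>_def L_def seg)
  have "\<exists>m\<in>{0..L n}. \<forall>t\<in>{0..L n}. dist ?p (\<sigma> n m) \<le> dist ?p (\<sigma> n t)" for n
  proof (rule continuous_attains_inf)
    have "continuous_on {0..L n} (\<sigma> n)"
      by (rule lipschitz_on_continuous_on[of 1], rule lipschitz_onI)
        (use isometric_onD[OF \<sigma>(1)] in \<open>auto simp: dist_real_def\<close>)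
    then show "continuous_on {0..L n} (\<lambda>t. dist ?p (\<sigma> n t))"
      by (intro continuous_intros)
  qed (auto simp: L_def)
  then obtain m where m: "\<And>n. m n \<in> {0..L n}"
    and nearest: "\<And>n t. t \<in> {0..L n} \<Longrightarrow> dist ?p (\<sigma> n (m n)) \<le> dist ?p (\<sigma> n t)"
    by metis
  define R where "R n = dist ?p (\<sigma> n (m n))" for n
  have Rinf: "\<forall>\<^sub>F n in sequentially. B < R n" for B
    using far[of B]
  proof eventually_elim
    case (elim n)
    then show ?case using m[of n] by (auto simp: R_def \<sigma>_def L_def dist_seg)
  qed
  define good where "good n x y \<longleftrightarrow> dist (c (real n)) y = dist (c (real n)) x + dist x y \<and>
    dist ?p x \<in> {R n..C * R n} \<and> dist ?p y \<in> {R n..C * R n} \<and>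
    dist (seg ?p x K) (c K) = 1 / 2 \<and> dist (seg ?p y K) (d K) \<le> 1 / 2" for n x y
  have "\<forall>\<^sub>F n in sequentially. K < R n \<and> (\<exists>x y. good n x y)"
    using Rinf[of K]
  proof eventually_elim
    case (elim n)
    then show ?case
      unfolding good_def C_def using nearest[of _ n] K m[of n]
      by (intro conjI escaping_segment_points[OF raysD(1)[OF c] raysD(1)[OF d] cd _ \<sigma>])
        (auto simp: R_def)
  qed
  then obtain N where "\<And>n. n \<ge> N \<Longrightarrow> K < R n \<and> (\<exists>x y. good n x y)"
    by (auto simp: eventually_sequentially)
  \<comment> \<open>The shift by \<open>N\<close> makes the choice total: \<open>x n\<close> and
    \<open>y n\<close> belong to the segment of index \<open>n + N\<close>, hence the index
    \<open>\<rho> n + N\<close> below.\<close>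
  then have "\<forall>n. \<exists>x y. K < R (n + N) \<and> good (n + N) x y" by simp
  then obtain x y where KR: "\<And>n. K < R (n + N)" and good: "\<And>n. good (n + N) (x n) (y n)"
    by metis
  have far_xy: "\<forall>\<^sub>F n in sequentially. t \<le> dist ?p (x n) \<and> t \<le> dist ?p (y n)" for t
    using eventually_all_ge_at_top[OF Rinf[of t]] eventually_ge_at_top[of N]
  proof eventually_elim
    case (elim n)
    then have "t < R (n + N)" by simp
    then show ?case using good[of n] by (auto simp: good_def)
  qed
  obtain r1 g where r1: "strict_mono (r1 :: nat \<Rightarrow> nat)" and g: "isometric_on {0..} g"
    and limg: "\<And>t. t \<in> {0..} \<Longrightarrow> (\<lambda>n. seg ?p (x (r1 n)) t) \<longlonglongrightarrow> g t"
  proof (rule isometric_subsequence_limit[of "\<lambda>n. {0..dist ?p (x n)}" "\<lambda>n. seg ?p (x n)" "{0..}" ?p 0])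
    show "\<forall>\<^sub>F n in sequentially. t \<in> {0..dist ?p (x n)}" if "t \<in> {0..}" for t
      using far_xy[of t] by eventually_elim (use that in auto)
  qed (auto simp: seg)
  \<comment> \<open>The second extraction runs inside the first, so that one subsequence
    \<open>\<rho>\<close> serves both directions.\<close>
  obtain r2 h where r2: "strict_mono (r2 :: nat \<Rightarrow> nat)" and h: "isometric_on {0..} h"
    and limh: "\<And>t. t \<in> {0..} \<Longrightarrow> (\<lambda>n. seg ?p (y (r1 (r2 n))) t) \<longlonglongrightarrow> h t"
  proof (rule isometric_subsequence_limit[of "\<lambda>n. {0..dist ?p (y (r1 n))}" "\<lambda>n. seg ?p (y (r1 n))" "{0..}" ?p 0])
    show "\<forall>\<^sub>F n in sequentially. t \<in> {0..dist ?p (y (r1 n))}" if "t \<in> {0..}" for t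
      using eventually_subseq[OF r1 far_xy[of t]] by eventually_elim (use that in auto)
  qed (auto simp: seg)
  define \<rho> where "\<rho> n = r1 (r2 n)" for n
  have \<rho>: "strict_mono \<rho>" using r1 r2 by (simp add: strict_mono_def \<rho>_def)
  have limx: "(\<lambda>n. seg ?p (x (\<rho> n)) t) \<longlonglongrightarrow> g t"
    and limy: "(\<lambda>n. seg ?p (y (\<rho> n)) t) \<longlonglongrightarrow> h t" if "0 \<le> t" for t
    using LIMSEQ_subseq_LIMSEQ[OF limg r2, of t] limh[of t] that by (auto simp: \<rho>_def o_def)
  have g0: "g 0 = ?p" "h 0 = ?p"
    using LIMSEQ_unique[OF limx[of 0]] LIMSEQ_unique[OF limy[of 0]] by (auto simp: seg)
  have half: "dist (seg ?p (x n) K) (c K) = 1 / 2" "dist (seg ?p (y n) K) (d K) \<le> 1 / 2" for n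
    using good[of n] unfolding good_def by blast+
  have "(\<lambda>n. dist (seg ?p (x (\<rho> n)) K) (c K)) \<longlonglongrightarrow> dist (g K) (c K)"
    using K by (intro tendsto_dist limx tendsto_const) simp
  then have gK: "dist (g K) (c K) = 1 / 2"
    unfolding half(1) LIMSEQ_const_iff by simp
  have hK: "dist (h K) (d K) \<le> 1 / 2"
    by (rule tendsto_upperbound[OF tendsto_dist[OF limy[of K] tendsto_const]]) (use half K in auto)
  define c' where "c' = (\<lambda>t\<in>{0..}. g t)"
  define d' where "d' = (\<lambda>t\<in>{0..}. h t)"
  have c': "c' \<in> rays" "c' 0 = ?p" and d': "d' \<in> rays" "d' 0 = ?p"
    using restrict_in_rays g h g0 by (auto simp: c'_def d'_def)
  have "\<not> Td_less_pi ?p (ray_end c') (ray_end d')"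
    using gK hK K c' d' by (intro U) (auto simp: c'_def d'_def dist_commute)
  then have wide: "\<forall>\<^sub>F t in at_top. dist (c' t) (d' t) > 2 * t * q" if "q < 1" for q
    using not_Td_less_piD[OF ray_end_in_boundary[OF c'(1)] ray_end_in_boundary[OF d'(1)] _ that, of ?p]
      ray_from_ray_end[OF c'(1)] ray_from_ray_end[OF d'(1)] c'(2) d'(2) by simp
  have "g K = c K"
  proof (rule point_on_ray[OF raysD(1)[OF c], where s = "\<lambda>n. real (\<rho> n + N)"])
    show "dist ?p (g K) = K" using isometric_onD[OF g, of 0 K] g0 K by simp
    have "filterlim (\<lambda>n. \<rho> n + N) sequentially sequentially"
      using \<rho> by (intro filterlim_subseq) (simp add: strict_mono_def)
    then show "filterlim (\<lambda>n. real (\<rho> n + N)) at_top sequentially"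
      by (rule filterlim_compose[OF filterlim_real_sequentially])
  next
    fix e :: real assume e: "0 < e"
    \<comment> \<open>This \<open>q\<close> makes the error in \<open>dist X Y\<close> at most
      \<open>e / (2 * K) * a\<close> with \<open>a = dist ?p X\<close>. Convexity down to radius
      \<open>K\<close> multiplies it by \<open>K / a\<close>, leaving \<open>e / 2\<close>; the
      other \<open>e / 2\<close> pays for replacing the shadow by its limit
      \<open>g K\<close>.\<close>
    define q where "q = 1 - e / (4 * K * C)"
    have q: "q < 1" using e K C0 by (simp add: q_def)
    have "\<forall>\<^sub>F t in at_top. 0 < t \<and> dist (c' t) (d' t) > 2 * t * q"
      using wide[OF q] eventually_gt_at_top[of 0] by eventually_elim auto
    then obtain T where T: "0 < T" "2 * T * q < dist (g T) (h T)"
      by (auto simp: eventually_at_top_linorder c'_def d'_def)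
    \<comment> \<open>One radius \<open>T\<close> suffices: the strict inequality passes from the
      limit rays to the segments, and \<open>dist_geodesics_lower_bound\<close> extends it to their
      far ends.\<close>
    have "(\<lambda>n. dist (seg ?p (x (\<rho> n)) T) (seg ?p (y (\<rho> n)) T)) \<longlonglongrightarrow> dist (g T) (h T)"
      using limx[of T] limy[of T] T by (intro tendsto_dist) auto
    from order_tendstoD(1)[OF this T(2)]
    have ev1: "\<forall>\<^sub>F n in sequentially. 2 * T * q < dist (seg ?p (x (\<rho> n)) T) (seg ?p (y (\<rho> n)) T)" .
    have ev2: "\<forall>\<^sub>F n in sequentially. dist (seg ?p (x (\<rho> n)) K) (g K) < e / 2"
      using tendstoD[OF limx[of K], of "e / 2"] K e by simp
    show "\<forall>\<^sub>F n in sequentially. dist (g K) (c (real (\<rho> n + N))) \<le> real (\<rho> n + N) - K + e"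
      using ev1 ev2 eventually_subseq[OF \<rho> far_xy[of T]]
    proof eventually_elim
      case (elim n)
      define X Y s where "X = x (\<rho> n)" and "Y = y (\<rho> n)" and "s = real (\<rho> n + N)"
      define a b \<RR> where "a = dist ?p X" and "b = dist ?p Y" and "\<RR> = R (\<rho> n + N)"
      have G: "dist (c s) Y = dist (c s) X + dist X Y" "\<RR> \<le> a" "a \<le> C * \<RR>" "b \<le> C * \<RR>"
        using good[of "\<rho> n"] by (auto simp: good_def X_def Y_def s_def a_def b_def \<RR>_def)
      have K\<RR>: "K < \<RR>" using KR by (simp add: \<RR>_def)
      have "a + b - 2 * (1 - q) * max a b \<le> dist (seg ?p X a) (seg ?p Y b)"
        unfolding a_def b_def
        using elim T by (intro dist_geodesics_lower_bound[of _ _ _ _ T] isometric_seg)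
          (auto simp: seg X_def Y_def)
      then have "a + b - 2 * (1 - q) * max a b \<le> dist X Y" by (simp add: a_def b_def seg_finish)
      moreover have "2 * (1 - q) * max a b \<le> 2 * (1 - q) * (C * \<RR>)"
        using G q by (intro mult_left_mono) auto
      moreover have "2 * (1 - q) * (C * \<RR>) = e / (2 * K) * \<RR>"
        using C0 K by (simp add: q_def field_simps)
      moreover have ps: "dist ?p (c s) = s" using raysD(2)[OF c, of 0 s] by (simp add: s_def)
      moreover have "dist (c s) Y \<le> s + b"
        using dist_triangle[of "c s" Y ?p] ps by (simp add: b_def dist_commute)
      ultimately have "dist (c s) X \<le> s - a + e / (2 * K) * \<RR>" using G(1) by linarith
      also have "\<dots> \<le> s - a + e / (2 * K) * a"
        using G(2) e K by (intro add_left_mono mult_left_mono) auto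
      finally have cX: "dist X (c s) \<le> s - a + e / (2 * K) * a" by (simp add: dist_commute)
      have a: "K < a" using K\<RR> G(2) by simp
      have X: "isometric_on {0..a} (seg ?p X)" "seg ?p X 0 = ?p" "seg ?p X a = X"
        by (simp_all add: a_def seg)
      \<comment> \<open>Convexity of the distance to \<open>c s\<close> along the segment from
        \<open>?p\<close> to \<open>X\<close> reduces an error proportional to \<open>a\<close> to a
        bounded small one.\<close>
      have "isometric_on {0..0} (\<lambda>_. c s)" by (simp add: isometric_on_def)
      from geodesic_convex[OF X(1) this, of "K / a"]
      have "dist (seg ?p X K) (c s) \<le> (1 - K / a) * s + K / a * dist X (c s)"
        using a K ps X by simp
      also have "\<dots> \<le> (1 - K / a) * s + K / a * (s - a + e / (2 * K) * a)"
        using cX a K by (intro add_left_mono mult_left_mono) auto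
      also have "\<dots> = s - K + e / 2"
        using a K by (simp add: field_simps)
      finally show ?case
        using elim(2) dist_triangle[of "g K" "c s" "seg ?p X K"]
        by (simp add: X_def s_def dist_commute)
    qed
  qed (use K in auto)
  then show False using gK by simp
qed

section \<open>Choice of the common radius \<open>K\<close> and conclusion\<close>

theorem theorem3p1:
  fixes p :: "'a::{proper_space, busemann_space}"
    and \<xi> \<eta> :: "(real \<Rightarrow> 'a) set"
  assumes "\<xi> \<in> geodesic_boundary" and "\<eta> \<in> geodesic_boundary"
    and "Td_greater_pi p \<xi> \<eta>"
  shows "\<exists>a :: real \<Rightarrow> 'a. geodesic_line a \<and> end_neg a = \<xi> \<and> end_pos a = \<eta>"
proof -
  define c d where "c = ray_from p \<xi>" and "d = ray_from p \<eta>"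
  have c: "c \<in> rays" "c 0 = p" "ray_end c = \<xi>" and d: "d \<in> rays" "d 0 = p" "ray_end d = \<eta>"
    using ray_from[OF assms(1), of p] ray_from[OF assms(2), of p] by (auto simp: c_def d_def)
  obtain U V where UV: "cone_nbhd p \<xi> U" "cone_nbhd p \<eta> V"
    "\<And>\<xi>' \<eta>'. \<xi>' \<in> U \<Longrightarrow> \<eta>' \<in> V \<Longrightarrow> \<not> Td_less_pi p \<xi>' \<eta>'"
    using assms(3) unfolding Td_greater_pi_def Td_le_pi_def by blast
  obtain K1 K2 where K12: "0 < K1" "cone_basic_nbhd p \<xi> K1 \<subseteq> U" "0 < K2" "cone_basic_nbhd p \<eta> K2 \<subseteq> V"
    using UV(1,2) unfolding cone_nbhd_def by blast
  have "\<xi> \<in> cone_basic_nbhd p \<xi> K1" "\<eta> \<in> cone_basic_nbhd p \<eta> K2"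
    using assms by (auto simp: cone_basic_nbhd_def)
  then have "\<not> Td_less_pi p \<xi> \<eta>" using UV(3) K12 by blast
  \<comment> \<open>The rate \<open>1 / 2\<close> reads \<open>t < dist (c t) (d t)\<close>, so
    every large radius \<open>K\<close> separates \<open>c K\<close> and \<open>d K\<close> by more
    than 1.\<close>
  from not_Td_less_piD[OF assms(1,2) this, of "1 / 2"]
  have "\<forall>\<^sub>F t in at_top. t < dist (c t) (d t)" by (simp add: c_def d_def)
  then have "\<forall>\<^sub>F K in at_top. K < dist (c K) (d K) \<and> max 1 (max K1 K2) \<le> K"
    using eventually_ge_at_top[of "max 1 (max K1 K2)"] by eventually_elim auto
  then obtain K where K: "K < dist (c K) (d K)" "1 \<le> K" "K1 \<le> K" "K2 \<le> K"
    by (auto simp: eventually_at_top_linorder)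
  have "\<not> Td_less_pi (c 0) (ray_end c') (ray_end d')"
    if "c' \<in> rays" "d' \<in> rays" "c' 0 = c 0" "d' 0 = c 0" "dist (c K) (c' K) < 1"
      "dist (d K) (d' K) < 1" for c' d'
  proof -
    \<comment> \<open>A ray from \<open>p\<close> is \<open>ray_from p\<close> of its own class, so
      closeness at radius \<open>K\<close> is membership in the basic neighbourhood.\<close>
    have "ray_end c' \<in> cone_basic_nbhd p \<xi> K" "ray_end d' \<in> cone_basic_nbhd p \<eta> K"
      using that ray_end_in_boundary[of c'] ray_end_in_boundary[of d']
        ray_from_ray_end[of c'] ray_from_ray_end[of d'] c d
      by (auto simp: cone_basic_nbhd_def c_def[symmetric] d_def[symmetric])
    then have "ray_end c' \<in> U" "ray_end d' \<in> V"
      using cone_basic_nbhd_mono[OF assms(1) K12(1) K(3)] cone_basic_nbhd_mono[OF assms(2) K12(3) K(4)]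
        K12 by blast+
    then show ?thesis using UV(3) c by simp
  qed
  moreover have cd: "c 0 = d 0" and "1 < dist (c K) (d K)" using c d K by simp_all
  ultimately obtain R where "\<exists>\<^sub>F n in sequentially. \<exists>z. dist (c 0) z \<le> R \<and>
      dist (c (real n)) z + dist z (d (real n)) = dist (c (real n)) (d (real n))"
    using frequently_segment_near[OF c(1) d(1) cd K(2)] by blast
  from geodesic_line_between[OF c(1) d(1) cd this] show ?thesis using c d by simp
qed

end
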